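(* Let $\mathfrak g$ be a nilpotent Lie algebra of real dimension $8$. If $\mathfrak g$ admits a strongly non-nilpotent complex structure, then the ascending type of $\mathfrak g$ is one of $(1,3,8)$, $(1,3,5,8)$, $(1,3,6,8)$, $(1,3,5,6,8)$, $(1,4,8)$, $(1,4,6,8)$, $(1,5,8)$, $(1,5,6,8)$.
   Context: Lie algebras are real and finite-dimensional. The ascending central series of $\mathfrak g$ is $\mathfrak g_0=\{0\}$, $\mathfrak g_k=\{X\in\mathfrak g \mid [X,\mathfrak g]\subseteq \mathfrak g_{k-1}\}$ for $k\geq 1$. For nilpotent $\mathfrak g$, the nilpotency step $s$ is the smallest integer $s\ge 1$ with $\mathfrak g_s=\mathfrak g$, and the ascending type of $\mathfrak g$ is the $s$-tuple $(\dim\mathfrak g_1,\ldots,\dim\mathfrak g_s)$. A complex structure on $\mathfrak g$ is a linear endomorphism $J:\mathfrak g\to\mathfrak g$ with $J^2=-\mathrm{Id}$ and $[X,Y]+J[JX,Y]+J[X,JY]-[JX,JY]=0$ for all $X,Y\in\mathfrak g$. Let $\mathfrak a_1(J)=\{X\in\mathfrak g \mid [X,\mathfrak g]=0 \text{ and } [JX,\mathfrak g]=0\}$. $J$ is called strongly non-nilpotent (SnN) if $\mathfrak a_1(J)=\{0\}$. *)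

theory Defs
  imports "HOL-Analysis.Analysis"
begin

text \<open>
  The underlying vector space of the Lie algebra is a whole type of class real_vector, and the
  bracket is a binary operation on that type. The library function dim yields 0 on
  infinite-dimensional spaces, so an assumption that the dimension of UNIV is a positive
  number entails finite-dimensionality.
\<close>

definition real_lie_algebra :: "('a::real_vector \<Rightarrow> 'a \<Rightarrow> 'a) \<Rightarrow> bool" where
  "real_lie_algebra br \<longleftrightarrow>
     bilinear br \<and>
     (\<forall>X. br X X = 0) \<and>
     (\<forall>X Y Z. br X (br Y Z) + br Y (br Z X) + br Z (br X Y) = 0)"

primrec ascending_central_series ::
    "('a::real_vector \<Rightarrow> 'a \<Rightarrow> 'a) \<Rightarrow> nat \<Rightarrow> 'a set" where
  "ascending_central_series br 0 = {0}"
| "ascending_central_series br (Suc k) = {X. \<forall>Y. br X Y \<in> ascending_central_series br k}"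

definition nilpotent_lie :: "('a::real_vector \<Rightarrow> 'a \<Rightarrow> 'a) \<Rightarrow> bool" where
  "nilpotent_lie br \<longleftrightarrow> (\<exists>s\<ge>1. ascending_central_series br s = UNIV)"

text \<open>The next two notions are meaningful for nilpotent algebras only.\<close>

definition nilpotency_step :: "('a::real_vector \<Rightarrow> 'a \<Rightarrow> 'a) \<Rightarrow> nat" where
  "nilpotency_step br = (LEAST s. s \<ge> 1 \<and> ascending_central_series br s = UNIV)"

definition ascending_type :: "('a::real_vector \<Rightarrow> 'a \<Rightarrow> 'a) \<Rightarrow> nat list" where
  "ascending_type br =
     map (\<lambda>k. dim (ascending_central_series br k)) [1..<Suc (nilpotency_step br)]"

definition complex_structure ::
    "('a::real_vector \<Rightarrow> 'a \<Rightarrow> 'a) \<Rightarrow> ('a \<Rightarrow> 'a) \<Rightarrow> bool" where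
  "complex_structure br J \<longleftrightarrow>
     linear J \<and>
     (\<forall>X. J (J X) = - X) \<and>
     (\<forall>X Y. br X Y + J (br (J X) Y) + J (br X (J Y)) - br (J X) (J Y) = 0)"

definition a\<^sub>1 :: "('a::real_vector \<Rightarrow> 'a \<Rightarrow> 'a) \<Rightarrow> ('a \<Rightarrow> 'a) \<Rightarrow> 'a set" where
  "a\<^sub>1 br J = {X. (\<forall>Y. br X Y = 0) \<and> (\<forall>Y. br (J X) Y = 0)}"

definition strongly_non_nilpotent ::
    "('a::real_vector \<Rightarrow> 'a \<Rightarrow> 'a) \<Rightarrow> ('a \<Rightarrow> 'a) \<Rightarrow> bool" where
  "strongly_non_nilpotent br J \<longleftrightarrow> a\<^sub>1 br J = {0}"

end

theory Submission
  imports Defs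
begin

text \<open>
  Write \<open>C k\<close> for the terms of the ascending central series and
  \<open>B X Y = [J X, Y] + [X, J Y]\<close>. Integrability of \<open>J\<close> says exactly that \<open>B\<close> is bilinear
  over the complex numbers, and then \<open>[J X, J Y] = [X, Y] + J (B X Y)\<close>. If \<open>a \<in> C k\<close> and
  \<open>J a \<in> C (k + 1)\<close>, then all values \<open>B a U\<close> lie in \<open>C k\<close>, hence in its largest complex
  subspace. When \<open>C k\<close> is totally real this forces \<open>B a = 0\<close>, so that \<open>[J a, U] = - [a, J U]\<close>,
  \<open>J a \<in> C k\<close> and finally \<open>a = 0\<close>: the complex structure moves no nonzero vector of a totally
  real \<open>C k\<close> into \<open>C (k + 1)\<close>. Engel's theorem works in the opposite direction. For a real ideal
  \<open>L\<close> it produces vectors \<open>J b\<close> with \<open>b \<in> L\<close> whose brackets are small, and most of the proof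
  consists of collisions between the two.

  The main step is that a totally real term \<open>L = C k\<close> with \<open>k \<ge> 1\<close> has dimension at most 1. If the
  dimension is at least 3, then \<open>W = L + J L\<close> has complex codimension at most 1, so it is an
  ideal, and Engel's theorem on \<open>W / L\<close> gives a \<open>b \<noteq> 0\<close> in \<open>L\<close> with \<open>J b \<in> C (k + 1)\<close>, which is
  impossible. If the dimension is 2, the same reasoning applies to \<open>C k\<close> enlarged by one vector of
  \<open>C (k + 1)\<close> and yields a complete flag for \<open>B\<close>; the Jacobi identity modulo \<open>C (k - 1)\<close> then makes
  a nonzero vector \<open>b\<close> of \<open>C k\<close> central for \<open>B\<close>, and \<open>J b \<in> C k\<close> again.

  Strong non-nilpotency says that the centre is totally real, so the centre is a line spanned by
  some \<open>x\<close>. The term \<open>C 2\<close> has dimension at least 2, so it is not totally real; it contains a nonzero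
  complex subspace, of real dimension at least 2, and also a vector \<open>x\<close> outside its complex part,
  which gives dimension at least 3. Since \<open>ad (J x)\<close> annihilates
  \<open>C 2 + J (C 2)\<close> but not the whole algebra, this complex subspace has dimension at most 6, and
  it contains \<open>J x \<notin> C 2\<close>, so \<open>C 2\<close> has dimension at most 5. Two more collisions show that
  \<open>dim (C 2) = 4\<close> implies \<open>dim (C 3) \<ge> 6\<close> and that \<open>dim (C 2) = 3\<close> excludes \<open>dim (C 3) = 4\<close>. No term
  has codimension 1, and the dimensions increase strictly until they reach 8; this leaves the
  eight types.
\<close>

section \<open>Dimension in a finite-dimensional real vector space\<close>

text \<open>The dimension facts below are those of \<open>finite_dimensional_vector_space\<close>, interpreted with
  a basis that exists because the dimension of the whole space is positive, and restated for
  the constant \<open>dim\<close> of real vector spaces.\<close>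

lemma finite_dimensional_real_vector:
  assumes "0 < dim (UNIV :: ('a::real_vector) set)"
  obtains B :: "'a::real_vector set" where "finite_dimensional_vector_space (*\<^sub>R) B"
proof -
  obtain B :: "'a set" where B: "independent B" "UNIV \<subseteq> span B" "card B = dim (UNIV :: 'a set)"
    using real_vector.basis_exists[of "UNIV :: 'a set"] by (metis (no_types))
  have "finite B"
    using B(3) assms by (intro card_ge_0_finite) simp
  then have "finite_dimensional_vector_space (*\<^sub>R) B"
    using B by unfold_locales (auto simp: dependent_raw_def[symmetric] span_raw_def[symmetric])
  then show ?thesis
    by (rule that)
qed

lemma fd_dim_mono:
  fixes S T :: "'a::real_vector set"
  assumes "0 < dim (UNIV :: 'a set)" "S \<subseteq> T"
  shows "dim S \<le> dim T"
proof -
  obtain B :: "'a set" where "finite_dimensional_vector_space (*\<^sub>R) B"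
    using finite_dimensional_real_vector[OF assms(1)] .
  then interpret finite_dimensional_vector_space "(*\<^sub>R) :: real \<Rightarrow> 'a \<Rightarrow> 'a" B .
  show ?thesis
    using dim_subset[OF assms(2)] unfolding dim_raw_def .
qed

lemma fd_subspace_eq:
  fixes S T :: "'a::real_vector set"
  assumes "0 < dim (UNIV :: 'a set)" "subspace S" "subspace T" "S \<subseteq> T" "dim T \<le> dim S"
  shows "S = T"
proof -
  obtain B :: "'a set" where "finite_dimensional_vector_space (*\<^sub>R) B"
    using finite_dimensional_real_vector[OF assms(1)] .
  then interpret finite_dimensional_vector_space "(*\<^sub>R) :: real \<Rightarrow> 'a \<Rightarrow> 'a" B .
  show ?thesis
    using subspace_dim_equal[of S T] assms unfolding dim_raw_def subspace_raw_def by blast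
qed

lemma fd_dim_less:
  fixes S T :: "'a::real_vector set"
  assumes "0 < dim (UNIV :: 'a set)" "subspace S" "subspace T" "S \<subset> T"
  shows "dim S < dim T"
  using fd_subspace_eq[OF assms(1-3)] assms(4) by (auto simp: not_less[symmetric])

lemma fd_dim_sum_direct:
  fixes S T :: "'a::real_vector set"
  assumes "0 < dim (UNIV :: 'a set)" "subspace S" "subspace T" "S \<inter> T = {0}"
  shows "dim {x + y |x y. x \<in> S \<and> y \<in> T} = dim S + dim T"
proof -
  obtain B :: "'a set" where "finite_dimensional_vector_space (*\<^sub>R) B"
    using finite_dimensional_real_vector[OF assms(1)] .
  then interpret finite_dimensional_vector_space "(*\<^sub>R) :: real \<Rightarrow> 'a \<Rightarrow> 'a" B .
  show ?thesis
    using dim_sums_Int[of S T] assms(2-4) dim_singleton[of 0]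
    unfolding dim_raw_def subspace_raw_def by simp
qed

lemma fd_dim_injective_image:
  fixes S :: "'a::real_vector set" and f :: "'a \<Rightarrow> 'a"
  assumes "0 < dim (UNIV :: 'a set)" "linear f" "inj f"
  shows "dim (f ` S) = dim S"
proof -
  obtain B :: "'a set" where "finite_dimensional_vector_space (*\<^sub>R) B"
    using finite_dimensional_real_vector[OF assms(1)] .
  then interpret finite_dimensional_vector_space "(*\<^sub>R) :: real \<Rightarrow> 'a \<Rightarrow> 'a" B .
  interpret finite_dimensional_vector_space_pair_1 "(*\<^sub>R) :: real \<Rightarrow> 'a \<Rightarrow> 'a" B "(*\<^sub>R) :: real \<Rightarrow> 'a \<Rightarrow> 'a"
    by unfold_locales
  show ?thesis
    using dim_image_eq[of f S] assms(2,3) unfolding dim_raw_def linear_def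
    by (metis inj_on_subset subset_UNIV)
qed

lemma even_gap:
  fixes m n :: nat
  assumes "even n"
  shows "even m \<Longrightarrow> m < n \<Longrightarrow> m + 2 \<le> n" "even m \<Longrightarrow> n < m \<Longrightarrow> n + 2 \<le> m"
  using assms by presburger+

lemma dim_zero: "dim {0 :: 'a::real_vector} = 0"
  using real_vector.dim_le_card[of "{0 :: 'a::real_vector}" "{}"] by simp

definition adjoin :: "'a::real_vector set \<Rightarrow> 'a \<Rightarrow> 'a set" where
  "adjoin S v = {s + c *\<^sub>R v |s c. s \<in> S}"

lemma adjoinI: "s \<in> S \<Longrightarrow> s + c *\<^sub>R v \<in> adjoin S v"
  by (auto simp: adjoin_def)

lemma adjoinE:
  assumes "x \<in> adjoin S v"
  obtains s c where "s \<in> S" "x = s + c *\<^sub>R v"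
  using assms by (auto simp: adjoin_def)

lemma subset_adjoin: "S \<subseteq> adjoin S v"
proof
  fix s assume "s \<in> S"
  from adjoinI[OF this, of 0 v] show "s \<in> adjoin S v" by simp
qed

lemma adjoin_self: "subspace S \<Longrightarrow> v \<in> adjoin S v"
  using adjoinI[of 0 S 1 v] by (simp add: subspace_0)

lemma adjoin_least: "\<lbrakk>subspace T; S \<subseteq> T; v \<in> T\<rbrakk> \<Longrightarrow> adjoin S v \<subseteq> T"
  by (auto simp: adjoin_def intro!: subspace_add subspace_scale)

lemma adjoin_eq_span:
  assumes "subspace S"
  shows "adjoin S v = span (insert v S)"
proof -
  have "x \<in> adjoin S v \<longleftrightarrow> (\<exists>c. x - c *\<^sub>R v \<in> S)" for x
    unfolding adjoin_def by (auto simp: algebra_simps) (metis add_diff_cancel_left' add.commute diff_add_cancel)+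
  moreover have "span S = S" using span_eq_iff assms by blast
  ultimately show ?thesis
    unfolding set_eq_iff span_breakdown_eq by metis
qed

lemma subspace_adjoin: "subspace S \<Longrightarrow> subspace (adjoin S v)"
  by (simp add: adjoin_eq_span)

lemma fd_dim_adjoin:
  fixes S :: "'a::real_vector set"
  assumes "0 < dim (UNIV :: 'a set)" "subspace S" "v \<notin> S"
  shows "dim (adjoin S v) = Suc (dim S)"
proof -
  obtain B :: "'a set" where "finite_dimensional_vector_space (*\<^sub>R) B"
    using finite_dimensional_real_vector[OF assms(1)] .
  then interpret finite_dimensional_vector_space "(*\<^sub>R) :: real \<Rightarrow> 'a \<Rightarrow> 'a" B .
  have "dim (insert v S) = Suc (dim S)"
    using dim_insert[of v S] assms(2,3) span_eq_iff[of S]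
    unfolding dim_raw_def span_raw_def subspace_raw_def by simp
  then show ?thesis
    using adjoin_eq_span[OF assms(2)] by simp
qed

section \<open>The ascending central series\<close>

locale nilpotent_complex =
  fixes br :: "'a::real_vector \<Rightarrow> 'a \<Rightarrow> 'a" and J :: "'a \<Rightarrow> 'a"
  assumes lie: "real_lie_algebra br"
    and dim8: "dim (UNIV :: 'a set) = 8"
    and nilp: "nilpotent_lie br"
    and cplx: "complex_structure br J"
begin

abbreviation C :: "nat \<Rightarrow> 'a set" where
  "C \<equiv> ascending_central_series br"

lemma fd: "0 < dim (UNIV :: 'a set)"
  using dim8 by simp

lemma bil: "bilinear br"
  using lie by (simp add: real_lie_algebra_def)

lemmas br_simps = bilinear_ladd[OF bil] bilinear_radd[OF bil] bilinear_lmul[OF bil]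
  bilinear_rmul[OF bil] bilinear_lneg[OF bil] bilinear_rneg[OF bil] bilinear_lzero[OF bil]
  bilinear_rzero[OF bil] bilinear_lsub[OF bil] bilinear_rsub[OF bil]

lemma br_self [simp]: "br X X = 0"
  using lie by (simp add: real_lie_algebra_def)

lemma br_swap: "br Y X = - br X Y"
proof -
  have "br (X + Y) (X + Y) = 0" by simp
  then show ?thesis
    unfolding br_simps by (simp add: eq_neg_iff_add_eq_0 add.commute)
qed

lemma jacobi: "br X (br Y Z) = br (br X Y) Z + br Y (br X Z)"
proof -
  have "br X (br Y Z) + br Y (br Z X) + br Z (br X Y) = 0"
    using lie by (simp add: real_lie_algebra_def)
  moreover have "br Y (br Z X) = - br Y (br X Z)" "br Z (br X Y) = - br (br X Y) Z"
    using br_swap by (metis bilinear_rneg[OF bil])+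
  ultimately show ?thesis
    by (simp add: algebra_simps)
qed

lemma linJ: "linear J"
  using cplx by (simp add: complex_structure_def)

lemmas J_simps = linear_add[OF linJ] linear_cmul[OF linJ] linear_neg[OF linJ] linear_0[OF linJ]
  linear_diff[OF linJ]

lemma JJ [simp]: "J (J X) = - X"
  using cplx by (simp add: complex_structure_def)

lemma subspace_C: "subspace (C k)"
proof (induction k)
  case 0
  show ?case by simp
next
  case (Suc k)
  then show ?case
    by (auto simp: subspace_def br_simps)
qed

lemma C_0 [simp]: "0 \<in> C k"
  using subspace_C subspace_0 by blast

lemmas C_add = subspace_add[OF subspace_C]
lemmas C_diff = subspace_diff[OF subspace_C]
lemmas C_neg = subspace_neg[OF subspace_C]
lemmas C_scale = subspace_scale[OF subspace_C]
lemmas C_closed = C_add C_diff C_neg C_scale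

lemma C_SucD: "X \<in> C (Suc k) \<Longrightarrow> br X Y \<in> C k"
  by simp

lemma C_SucD': "X \<in> C (Suc k) \<Longrightarrow> br Y X \<in> C k"
  using C_SucD C_neg br_swap by metis

lemma C_SucI: "(\<And>Y. br X Y \<in> C k) \<Longrightarrow> X \<in> C (Suc k)"
  by simp

lemma C_step: "C k \<subseteq> C (Suc k)"
proof (induction k)
  case 0
  show ?case by (auto simp: br_simps)
next
  case (Suc k)
  then show ?case by auto
qed

lemma C_mono: "i \<le> k \<Longrightarrow> C i \<subseteq> C k"
  using lift_Suc_mono_le[of C] C_step by blast

lemma C_ideal: "X \<in> C k \<Longrightarrow> br X Y \<in> C k"
  using C_SucD C_step by blast

lemma C_ideal': "X \<in> C k \<Longrightarrow> br Y X \<in> C k"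
  using C_SucD' C_step by blast

declare ascending_central_series.simps(2) [simp del]

lemma C_exhausts: obtains m where "C m = UNIV"
  using nilp by (auto simp: nilpotent_lie_def)

text \<open>This is what remains of Engel's theorem once the central series is at hand: for the least
  \<open>m\<close> such that \<open>C m\<close> meets \<open>T\<close> outside \<open>S\<close>, any element of \<open>T \<inter> C m\<close> outside \<open>S\<close> will do,
  because its brackets lie in \<open>T \<inter> C (m - 1)\<close>.\<close>

lemma engel:
  assumes "\<And>t U. t \<in> T \<Longrightarrow> br t U \<in> T" "0 \<in> S" "\<not> T \<subseteq> S"
  obtains t where "t \<in> T" "t \<notin> S" "\<And>U. br t U \<in> S"
proof -
  obtain m where m: "C m = UNIV" using C_exhausts .
  define P where "P m \<longleftrightarrow> \<not> T \<inter> C m \<subseteq> S" for m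
  have "P m" using m assms(3) by (simp add: P_def)
  then have least: "P (LEAST m. P m)" by (rule LeastI)
  have "\<not> P 0" using assms(2) by (auto simp: P_def)
  then have "(LEAST m. P m) \<noteq> 0" using least by (intro notI) simp
  then obtain i where i: "(LEAST m. P m) = Suc i" by (cases "LEAST m. P m") auto
  obtain t where t: "t \<in> T" "t \<in> C (Suc i)" "t \<notin> S"
    using least unfolding i by (auto simp only: P_def)
  have "\<not> P i" using not_less_Least[of i P] i by simp
  then have "br t U \<in> S" for U
    using assms(1)[OF t(1), of U] C_SucD[OF t(2), of U] by (auto simp: P_def)
  with t that show thesis by blast
qed

text \<open>Otherwise \<open>- 1\<close> would be an eigenvalue of the nilpotent map \<open>ad U\<close> on the quotient by \<open>S\<close>.\<close>

lemma no_eigenvector: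
  assumes S: "subspace S" and inv: "\<And>s. s \<in> S \<Longrightarrow> br s U \<in> S" and v: "br v U - v \<in> S"
  shows "v \<in> S"
proof -
  have "(\<exists>c\<in>C k. v - c \<in> S) \<Longrightarrow> v \<in> S" for k
  proof (induction k)
    case 0
    then show ?case by simp
  next
    case (Suc k)
    then obtain c where c: "c \<in> C (Suc k)" "v - c \<in> S" by blast
    have "br (v - c) U - (br v U - v) \<in> S"
      using inv[OF c(2)] v subspace_diff[OF S] by blast
    then have "v - br c U \<in> S"
      by (simp add: br_simps algebra_simps)
    then show ?case
      using Suc.IH C_SucD[OF c(1)] by blast
  qed
  moreover obtain m where "C m = UNIV" using C_exhausts .
  ultimately show ?thesis
    using subspace_0[OF S] by (metis UNIV_I cancel_comm_monoid_add_class.diff_cancel)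
qed

section \<open>Complex and totally real subspaces\<close>

text \<open>All dimensions are real, so a complex hyperplane has dimension 6.\<close>

definition csubspace :: "'a set \<Rightarrow> bool" where
  "csubspace W \<longleftrightarrow> subspace W \<and> (\<forall>v\<in>W. J v \<in> W)"

definition totally_real :: "'a set \<Rightarrow> bool" where
  "totally_real S \<longleftrightarrow> (\<forall>v\<in>S. J v \<in> S \<longrightarrow> v = 0)"

definition cspan :: "'a set \<Rightarrow> 'a set" where
  "cspan L = {a + J b |a b. a \<in> L \<and> b \<in> L}"

definition cpart :: "'a set \<Rightarrow> 'a set" where
  "cpart S = {v \<in> S. J v \<in> S}"

definition cadjoin :: "'a set \<Rightarrow> 'a \<Rightarrow> 'a set" where
  "cadjoin W w = adjoin (adjoin W w) (J w)"

lemma csubspaceD: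
  assumes "csubspace W"
  shows "subspace W" "v \<in> W \<Longrightarrow> J v \<in> W" "J v \<in> W \<Longrightarrow> v \<in> W"
proof -
  show W: "subspace W" and "v \<in> W \<Longrightarrow> J v \<in> W"
    using assms by (auto simp: csubspace_def)
  assume "J v \<in> W"
  then have "J (J v) \<in> W" using assms by (simp only: csubspace_def)
  then show "v \<in> W" using subspace_neg[OF W, of "- v"] by simp
qed

lemma csubspace_0: "csubspace {0}"
  by (simp add: csubspace_def J_simps)

lemma csubspace_cspan: assumes L: "subspace L" shows "csubspace (cspan L)"
  unfolding csubspace_def subspace_def
proof (intro conjI ballI allI)
  have "0 + J 0 \<in> cspan L"
    using subspace_0[OF L] unfolding cspan_def by blast
  then show "0 \<in> cspan L" by (simp add: J_simps)
next
  fix x y assume "x \<in> cspan L" "y \<in> cspan L"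
  then obtain a b c d where *: "a \<in> L" "b \<in> L" "c \<in> L" "d \<in> L" "x = a + J b" "y = c + J d"
    unfolding cspan_def by blast
  then have "x + y = (a + c) + J (b + d)" by (simp add: J_simps)
  then show "x + y \<in> cspan L"
    using * subspace_add[OF L] unfolding cspan_def by blast
next
  fix r x assume "x \<in> cspan L"
  then obtain a b where *: "a \<in> L" "b \<in> L" "x = a + J b"
    unfolding cspan_def by blast
  then have "r *\<^sub>R x = r *\<^sub>R a + J (r *\<^sub>R b)" by (simp add: J_simps scaleR_add_right)
  then show "r *\<^sub>R x \<in> cspan L"
    using * subspace_scale[OF L] unfolding cspan_def by blast
next
  fix x assume "x \<in> cspan L"
  then obtain a b where *: "a \<in> L" "b \<in> L" "x = a + J b"
    unfolding cspan_def by blast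
  then have "J x = - b + J a" by (simp add: J_simps)
  then show "J x \<in> cspan L"
    using * subspace_neg[OF L] unfolding cspan_def by blast
qed

lemma cspanI: "a \<in> L \<Longrightarrow> b \<in> L \<Longrightarrow> a + J b \<in> cspan L"
  unfolding cspan_def by blast

lemma cspanE:
  assumes "v \<in> cspan L"
  obtains a b where "a \<in> L" "b \<in> L" "v = a + J b"
  using assms unfolding cspan_def by blast

lemma cspan_superset: assumes "subspace L" shows "L \<subseteq> cspan L"
  using cspanI[of _ L 0] subspace_0[OF assms] by (auto simp: J_simps)

lemma J_cspan: assumes "subspace L" "b \<in> L" shows "J b \<in> cspan L"
  using cspanI[of 0 L b] subspace_0[OF assms(1)] assms(2) by simp

lemma cpart_subset: "cpart S \<subseteq> S"
  by (auto simp: cpart_def)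

lemma cpart_mono: "S \<subseteq> T \<Longrightarrow> cpart S \<subseteq> cpart T"
  by (auto simp: cpart_def)

lemma csubspace_cpart: "subspace S \<Longrightarrow> csubspace (cpart S)"
  by (auto simp: csubspace_def cpart_def subspace_def J_simps subspace_neg)

lemma csubspace_cadjoin: assumes W: "csubspace W" shows "csubspace (cadjoin W w)"
  unfolding csubspace_def
proof (intro conjI ballI)
  note sub = csubspaceD(1)[OF W]
  show "subspace (cadjoin W w)"
    unfolding cadjoin_def by (intro subspace_adjoin sub)
  fix v assume "v \<in> cadjoin W w"
  then obtain s c d where *: "s \<in> W" "v = s + c *\<^sub>R w + d *\<^sub>R J w"
    unfolding cadjoin_def by (metis adjoinE)
  have "J v = J s + (- d) *\<^sub>R w + c *\<^sub>R J w" by (simp add: * J_simps)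
  then show "J v \<in> cadjoin W w"
    unfolding cadjoin_def using csubspaceD(2)[OF W *(1)] by (metis adjoinI)
qed

lemma cadjoinE:
  assumes "v \<in> cadjoin W w"
  obtains s c d where "s \<in> W" "v = s + c *\<^sub>R w + d *\<^sub>R J w"
  using assms unfolding cadjoin_def by (metis adjoinE)

lemma cadjoinI: "s \<in> W \<Longrightarrow> s + c *\<^sub>R w + d *\<^sub>R J w \<in> cadjoin W w"
  unfolding cadjoin_def by (intro adjoinI)

text \<open>The combination \<open>c v + d J v\<close> is a complex multiple of \<open>v\<close>; multiplying by the conjugate
  number \<open>c - d J\<close> recovers a real multiple of \<open>v\<close>.\<close>

lemma complex_scale_eq_0:
  assumes "c *\<^sub>R v + d *\<^sub>R J v = 0" "c \<noteq> 0 \<or> d \<noteq> 0"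
  shows "v = 0"
proof -
  have "c *\<^sub>R (c *\<^sub>R v + d *\<^sub>R J v) - d *\<^sub>R J (c *\<^sub>R v + d *\<^sub>R J v) = 0"
    unfolding assms(1) by (simp add: J_simps)
  then have "(c * c + d * d) *\<^sub>R v = 0"
    by (simp add: J_simps algebra_simps)
  moreover have "c * c + d * d \<noteq> 0"
    using assms(2) by (simp add: sum_squares_eq_zero_iff)
  ultimately show ?thesis by (simp del: sum_squares_eq_zero_iff)
qed

lemma complex_scale_mem:
  assumes W: "csubspace W" and "c *\<^sub>R v + d *\<^sub>R J v \<in> W" "c \<noteq> 0 \<or> d \<noteq> 0"
  shows "v \<in> W"
proof -
  note sub = csubspaceD(1)[OF W]
  have "c *\<^sub>R (c *\<^sub>R v + d *\<^sub>R J v) - d *\<^sub>R J (c *\<^sub>R v + d *\<^sub>R J v) \<in> W"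
    by (intro subspace_diff subspace_scale sub csubspaceD(2)[OF W] assms(2))
  then have "(c * c + d * d) *\<^sub>R v \<in> W"
    by (simp add: J_simps algebra_simps)
  moreover have "c * c + d * d \<noteq> 0"
    using assms(3) by (simp add: sum_squares_eq_zero_iff)
  ultimately show ?thesis
    using subspace_scale[OF sub, of "(c * c + d * d) *\<^sub>R v" "inverse (c * c + d * d)"]
    by (simp del: sum_squares_eq_zero_iff)
qed

lemma dim_cadjoin:
  assumes W: "csubspace W" and w: "w \<notin> W"
  shows "dim (cadjoin W w) = dim W + 2"
proof -
  note sub = csubspaceD(1)[OF W]
  have "J w \<notin> adjoin W w"
  proof
    assume "J w \<in> adjoin W w"
    then obtain s c where s: "s \<in> W" "J w = s + c *\<^sub>R w" by (rule adjoinE)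
    then have "(- c) *\<^sub>R w + 1 *\<^sub>R J w \<in> W" by simp
    then have "w \<in> W" by (rule complex_scale_mem[OF W]) simp
    with w show False ..
  qed
  then show ?thesis
    unfolding cadjoin_def
    using fd_dim_adjoin[OF fd subspace_adjoin[OF sub]] fd_dim_adjoin[OF fd sub w] by simp
qed

lemma cadjoin_least: "csubspace W \<Longrightarrow> V \<subseteq> W \<Longrightarrow> w \<in> W \<Longrightarrow> cadjoin V w \<subseteq> W"
  unfolding cadjoin_def by (intro adjoin_least) (auto dest: csubspaceD)

lemma even_dim_csubspace:
  assumes W: "csubspace W"
  shows "even (dim W)"
proof -
  have "csubspace V \<Longrightarrow> V \<subseteq> W \<Longrightarrow> even (dim V) \<Longrightarrow> even (dim W)" for V
  proof (induction "dim W - dim V" arbitrary: V rule: less_induct)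
    case less
    show ?case
    proof (cases "V = W")
      case False
      then obtain w where w: "w \<in> W" "w \<notin> V" using less.prems by blast
      have 1: "cadjoin V w \<subseteq> W" using cadjoin_least[OF W] less.prems w by blast
      have 2: "dim (cadjoin V w) = dim V + 2" using dim_cadjoin less.prems w by blast
      have "dim (cadjoin V w) \<le> dim W" using fd_dim_mono[OF fd 1] .
      then show ?thesis
        using less.hyps[OF _ csubspace_cadjoin[OF less.prems(1)] 1] 2 less.prems(3) by simp
    qed (use less in simp)
  qed
  moreover have "dim {0 :: 'a} = 0"
    by (rule dim_zero)
  ultimately show ?thesis
    using csubspace_0 subspace_0[OF csubspaceD(1)[OF W]] by simp
qed

lemma dim_cspan_totally_real:
  assumes L: "subspace L" and tr: "totally_real L"
  shows "dim (cspan L) = 2 * dim L"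
proof -
  have sub: "subspace (J ` L)" using linear_subspace_image[OF linJ L] .
  have "L \<inter> J ` L = {0}"
    using tr subspace_0[OF L] subspace_0[OF sub]
    by (auto simp: totally_real_def J_simps)
  then have "dim {x + y |x y. x \<in> L \<and> y \<in> J ` L} = dim L + dim (J ` L)"
    using fd_dim_sum_direct[OF fd L sub] by simp
  moreover have "{x + y |x y. x \<in> L \<and> y \<in> J ` L} = cspan L"
    unfolding cspan_def by blast
  moreover have "inj J"
    by (metis JJ injI neg_equal_iff_equal)
  ultimately show ?thesis
    using fd_dim_injective_image[OF fd linJ] by simp
qed

text \<open>A complex hyperplane and any vector outside it span everything over the complex numbers.\<close>

lemma complex_complement:
  assumes W: "csubspace W" "6 \<le> dim W" and w: "w \<notin> W"
  obtains s c d where "s \<in> W" "v = s + c *\<^sub>R w + d *\<^sub>R J w"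
proof -
  have "cadjoin W w = UNIV"
    using fd_subspace_eq[OF fd csubspaceD(1)[OF csubspace_cadjoin[OF W(1)]], of UNIV w]
      dim_cadjoin[OF W(1) w] W(2) dim8 by simp
  then show ?thesis using cadjoinE[of v W w] that by blast
qed

section \<open>The complex bracket\<close>

text \<open>The map \<open>X \<mapsto> X + i J X\<close> identifies the algebra with the subalgebra of vectors of type
  \<open>(0,1)\<close> in its complexification, and the bracket of that subalgebra becomes
  \<open>[X, Y] - [J X, J Y] = - J (B X Y)\<close>.\<close>

definition B :: "'a \<Rightarrow> 'a \<Rightarrow> 'a" where
  "B X Y = br (J X) Y + br X (J Y)"

lemma br_JJ: "br (J X) (J Y) = br X Y + J (B X Y)"
proof -
  have "br X Y + J (br (J X) Y) + J (br X (J Y)) - br (J X) (J Y) = 0"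
    using cplx by (simp add: complex_structure_def)
  then show ?thesis by (simp add: B_def J_simps algebra_simps)
qed

lemma br_J: "br (J X) Y = B X Y - br X (J Y)"
  by (simp add: B_def)

lemma B_J_right: "B X (J Y) = J (B X Y)"
  using br_JJ[of X Y] by (simp add: B_def[of X "J Y"] br_simps)

lemma B_swap: "B Y X = - B X Y"
  unfolding B_def using br_swap[of "J Y" X] br_swap[of Y "J X"] by simp

lemma B_self [simp]: "B X X = 0"
  unfolding B_def using br_swap[of "J X" X] by simp

lemma B_simps:
  "B (X + Y) Z = B X Z + B Y Z" "B X (Y + Z) = B X Y + B X Z"
  "B (c *\<^sub>R X) Z = c *\<^sub>R B X Z" "B X (c *\<^sub>R Z) = c *\<^sub>R B X Z"
  "B (X - Y) Z = B X Z - B Y Z" "B X (Y - Z) = B X Y - B X Z"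
  "B (- X) Z = - B X Z" "B X (- Z) = - B X Z" "B 0 Z = 0" "B X 0 = 0"
  by (simp_all add: B_def br_simps J_simps algebra_simps)


text \<open>The first half of every collision: as \<open>B a\<close> is complex linear, its values lie
  in the complex part of \<open>C k\<close> once they lie in \<open>C k\<close>.\<close>

lemma B_in_cpart:
  assumes "a \<in> C k" "J a \<in> C (Suc k)"
  shows "B a U \<in> cpart (C k)"
proof -
  have "B a X \<in> C k" for X
    unfolding B_def by (intro C_add C_SucD[OF assms(2)] C_ideal[OF assms(1)])
  from this[of U] this[of "J U"] show ?thesis
    by (simp add: cpart_def B_J_right)
qed

text \<open>The second half: if \<open>B a = 0\<close>, the brackets of \<open>J a\<close> are, up to sign, brackets of \<open>a\<close>.\<close>

lemma J_mem_of_B_zero: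
  assumes "a \<in> C k" "\<And>U. B a U = 0"
  shows "J a \<in> C k"
proof (cases k)
  case 0
  then show ?thesis using assms(1) by (simp add: J_simps)
next
  case (Suc i)
  have "br (J a) U \<in> C i" for U
    unfolding br_J assms(2) using C_SucD[of a i "J U"] assms(1) C_neg Suc by simp
  then show ?thesis unfolding Suc by (rule C_SucI)
qed

lemma totally_real_step:
  assumes "totally_real (C k)" "a \<in> C k" "J a \<in> C (Suc k)"
  shows "a = 0"
proof -
  have "B a U = 0" for U
    using B_in_cpart[OF assms(2,3), of U] assms(1) by (auto simp: cpart_def totally_real_def)
  then have "J a \<in> C k" by (rule J_mem_of_B_zero[OF assms(2)])
  then show ?thesis using assms(1,2) by (auto simp: totally_real_def)
qed

text \<open>Let \<open>W\<close> be the complex span, assumed proper. Engel's theorem provides a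
  vector \<open>w\<close> outside \<open>W\<close> all of whose brackets lie in \<open>W\<close>. Since \<open>[J b, U]\<close> and \<open>B b U\<close> differ by an element of \<open>L\<close>, and since \<open>B b\<close> is
  complex linear, it is enough to control \<open>B b\<close> on \<open>L\<close> and at the single vector \<open>w\<close>.\<close>

lemma cspan_ideal:
  assumes L: "subspace L" and ideal: "\<And>a U. a \<in> L \<Longrightarrow> br a U \<in> L"
    and dim: "6 \<le> dim (cspan L)" and v: "v \<in> cspan L"
  shows "br v U \<in> cspan L"
proof (cases "UNIV \<subseteq> cspan L")
  case False
  note W = csubspace_cspan[OF L]
  note W_closed = subspace_add[OF csubspaceD(1)[OF W]] subspace_diff[OF csubspaceD(1)[OF W]]
    subspace_scale[OF csubspaceD(1)[OF W]] subspace_neg[OF csubspaceD(1)[OF W]]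
  have LW: "a \<in> L \<Longrightarrow> a \<in> cspan L" for a using cspan_superset[OF L] by blast
  have ideal': "br U a \<in> L" if "a \<in> L" for a U
    using ideal[OF that] br_swap[of U a] subspace_neg[OF L] by metis
  obtain w where w: "w \<notin> cspan L" "\<And>U. br w U \<in> cspan L"
    using engel[of UNIV "cspan L"] False subspace_0[OF csubspaceD(1)[OF W]] by blast
  have w': "br U w \<in> cspan L" for U
    using w(2)[of U] br_swap[of U w] W_closed(4) by metis
  have B: "B b X \<in> cspan L" if b: "b \<in> L" for b X
  proof -
    obtain s c d where s: "s \<in> cspan L" "X = s + c *\<^sub>R w + d *\<^sub>R J w"
      using complex_complement[OF W dim w(1)] .
    obtain p q where p: "p \<in> L" "q \<in> L" "s = p + J q"
      using cspanE[OF s(1)] .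
    have BL: "B b x \<in> L" if "x \<in> L" for x
      unfolding B_def using ideal[OF b] ideal'[OF that] subspace_add[OF L] by blast
    have "B b s \<in> cspan L"
      using cspanI[OF BL[OF p(1)] BL[OF p(2)]] by (simp add: p(3) B_simps B_J_right)
    moreover have Bw: "B b w \<in> cspan L"
      unfolding B_def by (intro W_closed w' LW ideal b)
    ultimately show ?thesis
      unfolding s(2) B_simps B_J_right
      by (intro W_closed csubspaceD(2)[OF W])
  qed
  obtain a b where ab: "a \<in> L" "b \<in> L" "v = a + J b"
    using cspanE[OF v] .
  show ?thesis
    unfolding ab(3) br_simps br_J
    by (intro W_closed LW[OF ideal] B ab)
qed auto

text \<open>The quotient by \<open>W\<close> is a nilpotent algebra of dimension at most 2, hence abelian.\<close>

lemma derived_in_hyperplane: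
  assumes W: "csubspace W" "6 \<le> dim W" and ideal: "\<And>v U. v \<in> W \<Longrightarrow> br v U \<in> W"
  shows "br X Y \<in> W"
proof (cases "UNIV \<subseteq> W")
  case False
  note sub = csubspaceD(1)[OF W(1)]
  note W_closed = subspace_add[OF sub] subspace_diff[OF sub] subspace_scale[OF sub]
    subspace_neg[OF sub]
  obtain w where w: "w \<notin> W" "\<And>U. br w U \<in> W"
    using engel[of UNIV W] False subspace_0[OF sub] by blast
  have w': "br U w \<in> W" for U
    using w(2)[of U] br_swap[of U w] W_closed(4) by metis
  have ideal': "br U v \<in> W" if "v \<in> W" for v U
    using ideal[OF that] br_swap[of U v] W_closed(4) by metis
  obtain s c d where s: "s \<in> W" "X = s + c *\<^sub>R w + d *\<^sub>R J w"
    using complex_complement[OF W w(1)] .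
  obtain s' c' d' where s': "s' \<in> W" "Y = s' + c' *\<^sub>R w + d' *\<^sub>R J w"
    using complex_complement[OF W w(1)] .
  have "br (J w) Y \<in> W"
    unfolding s'(2) br_simps by (intro W_closed ideal'[OF s'(1)] w') (simp add: subspace_0[OF sub])
  then show ?thesis
    unfolding s(2) br_simps by (intro W_closed ideal[OF s(1)] w)
qed auto

lemma B_zero_by_hyperplane:
  assumes W: "csubspace W" "6 \<le> dim W" and w: "w \<notin> W"
    and B: "B b w = 0" "\<And>s. s \<in> W \<Longrightarrow> B b s = 0"
  shows "B b U = 0"
proof -
  obtain s c d where "s \<in> W" "U = s + c *\<^sub>R w + d *\<^sub>R J w"
    using complex_complement[OF W w] .
  then show ?thesis using B by (simp add: B_simps B_J_right J_simps)
qed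

text \<open>Engel's theorem on the complex span of a real ideal \<open>L\<close>, where the vector it gives can be chosen
  purely imaginary because its real part lies in \<open>L\<close>.\<close>

lemma engel_imaginary:
  assumes L: "subspace L" and ideal: "\<And>a U. a \<in> L \<Longrightarrow> br a U \<in> L"
    and W: "\<And>v U. v \<in> cspan L \<Longrightarrow> br v U \<in> cspan L"
    and S: "subspace S" "L \<subseteq> S" "\<not> cspan L \<subseteq> S"
  obtains b where "b \<in> L" "J b \<notin> S" "\<And>U. br (J b) U \<in> S"
proof -
  obtain t where t: "t \<in> cspan L" "t \<notin> S" "\<And>U. br t U \<in> S"
    using engel[of "cspan L" S, OF W subspace_0[OF S(1)] S(3)] by blast
  obtain a b where ab: "a \<in> L" "b \<in> L" "t = a + J b"
    using cspanE[OF t(1)] .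
  have "J b \<notin> S"
    using t(2) ab S(2) subspace_add[OF S(1)] by blast
  moreover have "br (J b) U \<in> S" for U
    using subspace_diff[OF S(1) t(3), of "br a U" U] ideal[OF ab(1)] S(2) ab(3)
    by (auto simp: br_simps)
  ultimately show thesis using that ab(2) by blast
qed

section \<open>Totally real terms of the series\<close>

lemma totally_real_term_dim_less_3:
  assumes tr: "totally_real (C k)"
  shows "dim (C k) < 3"
proof (rule ccontr)
  assume "\<not> dim (C k) < 3"
  then have dim: "6 \<le> dim (cspan (C k))" "\<not> dim (cspan (C k)) \<le> dim (C k)"
    using dim_cspan_totally_real[OF subspace_C tr] by auto
  then have "\<not> cspan (C k) \<subseteq> C k"
    using fd_dim_mono[OF fd] by blast
  then obtain b where b: "b \<in> C k" "J b \<notin> C k" "\<And>U. br (J b) U \<in> C k"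
    using engel_imaginary[OF subspace_C C_ideal cspan_ideal[OF subspace_C C_ideal dim(1)] subspace_C]
    by blast
  then have "b = 0"
    using totally_real_step[OF tr b(1) C_SucI[OF b(3)]] by simp
  then show False using b(2) by (simp add: J_simps)
qed

text \<open>Write \<open>R = C i\<close> and \<open>Q = C (i + 1)\<close>. Enlarging \<open>Q\<close> by a vector of \<open>C (i + 2)\<close> gives a
  totally real ideal \<open>L\<close> of dimension 3, whose complex span \<open>W\<close> is a complex hyperplane. Three
  applications of Engel's theorem to \<open>W\<close> give a flag: a vector \<open>u\<close> of \<open>L\<close>, outside \<open>Q\<close>, with
  \<open>B u = 0\<close>, and a basis \<open>a1, a2\<close> of \<open>Q\<close> such that \<open>B a1\<close> takes values in the complex line of \<open>u\<close>
  and \<open>B a2\<close> in the complex span of \<open>u\<close> and \<open>a1\<close>. If \<open>B a1 w = u\<close>, then the Jacobi identity for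
  \<open>J a1\<close>, \<open>w\<close>, \<open>J w\<close> puts \<open>[u, J w]\<close> into \<open>R\<close>, while \<open>[u, w]\<close> cannot lie in \<open>R\<close> because \<open>u \<notin> Q\<close>.
  The same identity for \<open>J a2\<close> then shows that \<open>B a2 w\<close> is a real multiple of \<open>u\<close>, so that a
  nonzero real combination of \<open>a1\<close> and \<open>a2\<close> is central for \<open>B\<close>.\<close>

lemma totally_real_term_dim_not_2:
  assumes tr: "totally_real (C (Suc i))"
  shows "dim (C (Suc i)) \<noteq> 2"
proof
  assume dim_Q: "dim (C (Suc i)) = 2"
  have "\<not> UNIV \<subseteq> C (Suc i)"
    using dim_Q dim8 top.extremum_uniqueI[of "C (Suc i)"] by auto
  then obtain u0 where u0: "u0 \<notin> C (Suc i)" "\<And>U. br u0 U \<in> C (Suc i)"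
    using engel[of UNIV "C (Suc i)", OF UNIV_I C_0] by metis
  define L where "L = adjoin (C (Suc i)) u0"
  have L: "subspace L" "C (Suc i) \<subseteq> L"
    unfolding L_def by (intro subspace_adjoin subspace_C subset_adjoin)+
  note L_closed = subspace_add[OF L(1)] subspace_diff[OF L(1)] subspace_scale[OF L(1)]
    subspace_neg[OF L(1)]
  have L_step: "L \<subseteq> C (Suc (Suc i))"
    unfolding L_def by (intro adjoin_least subspace_C C_step C_SucI u0(2))
  have brL: "br a U \<in> C (Suc i)" if "a \<in> L" for a U
    using L_step that C_SucD by blast
  (* If v and J v are in L, the combination of them without u0 component is a vector b of Q with
     J b in the next term, so that b = 0. *)
  have trL: "v = 0" if v: "v \<in> L" "J v \<in> L" for v
  proof -
    obtain a c where a: "a \<in> C (Suc i)" "v = a + c *\<^sub>R u0"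
      using adjoinE v(1) unfolding L_def by blast
    obtain a' c' where a': "a' \<in> C (Suc i)" "J v = a' + c' *\<^sub>R u0"
      using adjoinE v(2) unfolding L_def by blast
    define b where "b = c' *\<^sub>R v - c *\<^sub>R J v"
    have "b = c' *\<^sub>R a - c *\<^sub>R a'"
      unfolding b_def a'(2) by (simp add: a(2) algebra_simps)
    then have 1: "b \<in> C (Suc i)"
      using C_diff[OF C_scale[OF a(1)] C_scale[OF a'(1)]] by simp
    have "J b = c' *\<^sub>R J v + c *\<^sub>R v"
      by (simp add: b_def J_simps)
    then have "J b \<in> C (Suc (Suc i))"
      using v L_closed L_step by (metis subsetD)
    then have "b = 0"
      by (rule totally_real_step[OF tr 1])
    then have eq: "c' *\<^sub>R v + (- c) *\<^sub>R J v = 0"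
      by (simp add: b_def)
    show ?thesis
    proof (cases "c' = 0 \<and> c = 0")
      case True
      then have "v \<in> C (Suc i)" "J v \<in> C (Suc i)" using a a' by auto
      then show ?thesis using tr by (simp add: totally_real_def)
    next
      case False
      then show ?thesis using complex_scale_eq_0[OF eq] by simp
    qed
  qed
  have dim_L: "dim L = 3"
    unfolding L_def using fd_dim_adjoin[OF fd subspace_C u0(1)] dim_Q by simp
  have dim_W: "dim (cspan L) = 6"
    using dim_cspan_totally_real[OF L(1)] trL dim_L by (simp add: totally_real_def)
  then have dim_W6: "6 \<le> dim (cspan L)" by simp
  note W = csubspace_cspan[OF L(1)]
  have L_ideal: "br a U \<in> L" if "a \<in> L" for a U
    using brL[OF that] L(2) by blast
  have W_ideal: "br v U \<in> cspan L" if "v \<in> cspan L" for v U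
    using cspan_ideal[OF L(1) L_ideal dim_W6 that] .
  have "\<not> cspan L \<subseteq> L"
    using fd_dim_mono[OF fd, of "cspan L" L] dim_W dim_L by auto
  then obtain u where u: "u \<in> L" "J u \<notin> L" "\<And>U. br (J u) U \<in> L"
    using engel_imaginary[OF L(1) L_ideal W_ideal L(1)] by blast
  have Bu: "B u U = 0" for U
  proof -
    have "B u X \<in> L" for X
      unfolding B_def by (intro L_closed u L_ideal)
    from this[of U] this[of "J U"] show ?thesis
      using trL by (simp add: B_J_right)
  qed
  have Bu': "B U u = 0" for U
    using Bu[of U] B_swap[of U u] by simp
  have u_Q: "u \<notin> C (Suc i)"
    using J_mem_of_B_zero[OF _ Bu] u(2) L(2) by blast
  have L_eq: "L = adjoin (C (Suc i)) u"
  proof (rule fd_subspace_eq[OF fd _ L(1), symmetric])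
    show "adjoin (C (Suc i)) u \<subseteq> L"
      by (intro adjoin_least L u)
    show "dim L \<le> dim (adjoin (C (Suc i)) u)"
      using fd_dim_adjoin[OF fd subspace_C u_Q] dim_Q dim_L by simp
  qed (intro subspace_adjoin subspace_C)
  have L_cases: "\<exists>q\<in>C (Suc i). \<exists>c. l = q + c *\<^sub>R u" if "l \<in> L" for l
    using that adjoinE unfolding L_eq by blast
  (* The second and third steps of the flag. The vector from engel_imaginary may be moved into Q
     because the brackets of J u already lie in L. *)
  define S1 where "S1 = adjoin L (J u)"
  have S1: "subspace S1" "L \<subseteq> S1" "dim S1 = 4" "J u \<in> S1"
    unfolding S1_def using subspace_adjoin[OF L(1)] subset_adjoin fd_dim_adjoin[OF fd L(1) u(2)] dim_L
      adjoin_self[OF L(1)] by auto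
  have flag: "\<exists>q\<in>C (Suc i). J q \<notin> S \<and> (\<forall>U. br (J q) U \<in> S)"
    if S: "subspace S" "S1 \<subseteq> S" "dim S < 6" for S
  proof -
    have "\<not> cspan L \<subseteq> S"
      using fd_dim_mono[OF fd, of "cspan L" S] dim_W S(3) by auto
    then obtain b where b: "b \<in> L" "J b \<notin> S" "\<And>U. br (J b) U \<in> S"
      using engel_imaginary[OF L(1) L_ideal W_ideal S(1)] S(2) S1(2) by blast
    obtain q c where q: "q \<in> C (Suc i)" "b = q + c *\<^sub>R u"
      using L_cases[OF b(1)] by blast
    have Jq: "J q = J b - c *\<^sub>R J u"
      by (simp add: q(2) J_simps)
    have "J b = J q + c *\<^sub>R J u"
      by (simp add: q(2) J_simps)
    moreover have "J u \<in> S" using S1(4) S(2) by blast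
    ultimately have "J q \<notin> S"
      using b(2) subspace_add[OF S(1)] subspace_scale[OF S(1)] by metis
    moreover have "br (J q) U \<in> S" for U
      unfolding Jq br_simps using b(3) u(3) S(2) S1(2) subspace_diff[OF S(1)] subspace_scale[OF S(1)]
      by blast
    ultimately show ?thesis using q(1) by blast
  qed
  have B_cpart: "B q U \<in> cpart S"
    if S: "subspace S" "S1 \<subseteq> S" and q: "q \<in> C (Suc i)" "\<forall>U. br (J q) U \<in> S" for S q U
  proof -
    have "B q X \<in> S" for X
    proof -
      have "br q (J X) \<in> S"
        using C_ideal[OF q(1)] L(2) S1(2) S(2) by blast
      then show ?thesis
        unfolding B_def using q(2) subspace_add[OF S(1)] by blast
    qed
    from this[of U] this[of "J U"] show ?thesis
      by (simp add: cpart_def B_J_right)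
  qed
  obtain a1 where a1: "a1 \<in> C (Suc i)" "J a1 \<notin> S1" "\<forall>U. br (J a1) U \<in> S1"
    using flag[OF S1(1)] S1(3) by auto
  (* The values of B a1 lie in the largest complex subspace of L + R (J u); as L is totally real,
     that is the complex line of u. *)
  have Ba1: "\<exists>c d. B a1 U = c *\<^sub>R u + d *\<^sub>R J u" for U
  proof -
    define z where "z = B a1 U"
    have z: "z \<in> S1" "J z \<in> S1"
      using B_cpart[OF S1(1) order_refl a1(1,3), of U] by (auto simp: cpart_def z_def)
    obtain l d where l: "l \<in> L" "z = l + d *\<^sub>R J u"
      using adjoinE[OF z(1)[unfolded S1_def]] .
    have "J l = J z + d *\<^sub>R u"
      by (simp add: l(2) J_simps)
    then have "J l \<in> S1"
      using subspace_add[OF S1(1) z(2)] subspace_scale[OF S1(1)] u(1) S1(2) by auto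
    then obtain l' c where l': "l' \<in> L" "J l = l' + c *\<^sub>R J u"
      unfolding S1_def by (rule adjoinE)
    have "J (l - c *\<^sub>R u) \<in> L"
      using l' by (simp add: J_simps)
    then have "l - c *\<^sub>R u = 0"
      by (intro trL L_closed l u) auto
    then have "z = c *\<^sub>R u + d *\<^sub>R J u"
      using l(2) by simp
    then show ?thesis unfolding z_def by blast
  qed
  have BQ: "B q q' \<in> C i" if "q \<in> C (Suc i)" "q' \<in> C (Suc i)" for q q'
    unfolding B_def by (intro C_add C_SucD[OF that(1)] C_SucD'[OF that(2)])
  have Ba1_Q: "B a1 q = 0" if q: "q \<in> C (Suc i)" for q
  proof -
    obtain c d where cd: "B a1 q = c *\<^sub>R u + d *\<^sub>R J u" using Ba1 by blast
    have mem: "B a1 q \<in> C (Suc i)" using BQ[OF a1(1) q] C_step by blast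
    have "d *\<^sub>R J u = B a1 q - c *\<^sub>R u" by (simp add: cd)
    also have "\<dots> \<in> L"
      using mem L(2) u(1) L_closed by blast
    finally have "d = 0"
      using u(2) subspace_scale[OF L(1), of "d *\<^sub>R J u" "inverse d"] by (cases "d = 0") auto
    moreover from this have "c = 0"
      using u_Q mem C_scale[of "c *\<^sub>R u" "Suc i" "inverse c"] unfolding cd by (cases "c = 0") auto
    ultimately show ?thesis by (simp add: cd)
  qed
  have Ba1_W: "B a1 v = 0" if "v \<in> cspan L" for v
  proof -
    have *: "B a1 l = 0" if "l \<in> L" for l
      using L_cases[OF that] Ba1_Q Bu' by (auto simp: B_simps)
    show ?thesis
      using that * by (auto simp: cspan_def B_simps B_J_right J_simps)
  qed
  obtain w where w: "B a1 w = u"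
  proof -
    have "\<exists>U. B a1 U \<noteq> 0"
      using J_mem_of_B_zero[OF a1(1)] a1(2) L(2) S1(2) by blast
    then obtain U where U: "B a1 U \<noteq> 0" by blast
    obtain c d where cd: "B a1 U = c *\<^sub>R u + d *\<^sub>R J u" using Ba1 by blast
    (* Multiplication by (c - d J) / n inverts the complex number c + d J. *)
    define n where "n = c * c + d * d"
    have n: "n \<noteq> 0"
      using U cd by (auto simp: n_def sum_squares_eq_zero_iff)
    have "B a1 (c *\<^sub>R U - d *\<^sub>R J U) = n *\<^sub>R u"
      by (simp add: B_simps B_J_right cd J_simps n_def algebra_simps)
    then have "B a1 (inverse n *\<^sub>R (c *\<^sub>R U - d *\<^sub>R J U)) = u"
      using n by (simp only: B_simps(4)) simp
    then show thesis by (rule that)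
  qed
  have u0: "u \<noteq> 0" using u_Q C_0 by blast
  have w_W: "w \<notin> cspan L"
    using Ba1_W[of w] w u0 by auto
  have kW: "br w (J w) \<in> cspan L"
    by (rule derived_in_hyperplane[OF W dim_W6 W_ideal])
  define S2 where "S2 = adjoin S1 (J a1)"
  have S2: "subspace S2" "S1 \<subseteq> S2" "dim S2 = 5" "J a1 \<in> S2"
    unfolding S2_def using subspace_adjoin[OF S1(1)] subset_adjoin fd_dim_adjoin[OF fd S1(1) a1(2)] S1(3)
      adjoin_self[OF S1(1)] by auto
  obtain a2 where a2: "a2 \<in> C (Suc i)" "J a2 \<notin> S2" "\<forall>U. br (J a2) U \<in> S2"
    using flag[OF S2(1,2)] S2(3) by auto
  have Q_cases: "\<exists>c d. q = c *\<^sub>R a1 + d *\<^sub>R a2" if "q \<in> C (Suc i)" for q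
  proof -
    have "a1 \<noteq> 0"
      using a1(2) subspace_0[OF S1(1)] by (auto simp: J_simps)
    then have 1: "dim (adjoin {0} a1) = 1" "subspace (adjoin {0} a1)"
      using fd_dim_adjoin[OF fd subspace_single_0, of a1] subspace_adjoin[OF subspace_single_0]
      by (auto simp: dim_zero)
    have "a2 \<notin> adjoin {0} a1"
      using a2(2) subspace_scale[OF S2(1) S2(4)] by (auto simp: adjoin_def J_simps)
    then have "dim (adjoin (adjoin {0} a1) a2) = 2"
      using fd_dim_adjoin[OF fd 1(2)] 1(1) by simp
    moreover have "adjoin (adjoin {0} a1) a2 \<subseteq> C (Suc i)"
      by (intro adjoin_least subspace_C a1(1) a2(1)) simp
    ultimately have "adjoin (adjoin {0} a1) a2 = C (Suc i)"
      using fd_subspace_eq[OF fd subspace_adjoin[OF 1(2)] subspace_C] dim_Q by simp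
    then have "q \<in> adjoin (adjoin {0} a1) a2" using that by simp
    then show ?thesis
      by (auto simp: adjoin_def)
  qed
  have BQL: "B q l = 0" if q: "q \<in> C (Suc i)" and l: "l \<in> L" for q l
  proof -
    obtain c d where cd: "q = c *\<^sub>R a1 + d *\<^sub>R a2" using Q_cases[OF q] by blast
    obtain q' e where q': "q' \<in> C (Suc i)" "l = q' + e *\<^sub>R u" using L_cases[OF l] by blast
    obtain c' d' where cd': "q' = c' *\<^sub>R a1 + d' *\<^sub>R a2" using Q_cases[OF q'(1)] by blast
    have "B a1 a2 = 0" using Ba1_Q[OF a2(1)] .
    moreover from this have "B a2 a1 = 0" using B_swap[of a2 a1] by simp
    ultimately show ?thesis
      by (simp add: cd cd' q'(2) B_simps Bu')
  qed
  have JQW: "br (J q) v \<in> C i" if q: "q \<in> C (Suc i)" and v: "v \<in> cspan L" for q v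
  proof -
    obtain a b where ab: "a \<in> L" "b \<in> L" "v = a + J b" using cspanE[OF v] .
    obtain q' c where q': "q' \<in> C (Suc i)" "a = q' + c *\<^sub>R u" using L_cases[OF ab(1)] by blast
    have "br (J q) u \<in> C i"
      unfolding br_J Bu' using C_neg[OF C_SucD[OF q]] by simp
    then have "br (J q) a \<in> C i"
      unfolding q'(2) br_simps by (intro C_closed C_SucD'[OF q'(1)])
    moreover have "br (J q) (J b) \<in> C i"
      unfolding br_JJ BQL[OF q ab(2)] using C_SucD[OF q] by (simp add: J_simps)
    ultimately show ?thesis
      unfolding ab(3) br_simps by (intro C_closed)
  qed
  have wJu: "br w (J u) = br u (J w)"
    using br_swap[of w "J u"] br_J[of u w] Bu by simp
  have a1w: "br (J a1) w = u - br a1 (J w)" "br (J a1) (J w) = br a1 w + J u"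
    using br_J[of a1 w] br_JJ[of a1 w] w by simp_all
  (* Jacobi for J a1, w, J w: modulo C i it reads 0 = 2 [u, J w]. *)
  have uJw: "br u (J w) \<in> C i"
  proof -
    have "br (J a1) (br w (J w)) = br (br (J a1) w) (J w) + br w (br (J a1) (J w))"
      by (rule jacobi)
    then have "2 *\<^sub>R br u (J w) = br (J a1) (br w (J w)) + br (br a1 (J w)) (J w) - br w (br a1 w)"
      unfolding a1w by (simp add: br_simps wJu scaleR_2 algebra_simps)
    also have "\<dots> \<in> C i"
      by (intro C_closed JQW a1(1) kW C_ideal C_ideal' C_SucD[OF a1(1)])
    finally show ?thesis
      using C_scale[of "2 *\<^sub>R br u (J w)" i "inverse 2"] by simp
  qed
  have uw: "br u w \<notin> C i"
  proof
    assume uw: "br u w \<in> C i"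
    have "br u U \<in> C i" for U
    proof -
      obtain s c d where s: "s \<in> cspan L" "U = s + c *\<^sub>R w + d *\<^sub>R J w"
        using complex_complement[OF W dim_W6 w_W] .
      obtain a b where ab: "a \<in> L" "b \<in> L" "s = a + J b" using cspanE[OF s(1)] .
      obtain q e where q: "q \<in> C (Suc i)" "a = q + e *\<^sub>R u" using L_cases[OF ab(1)] by blast
      obtain q' e' where q': "q' \<in> C (Suc i)" "b = q' + e' *\<^sub>R u" using L_cases[OF ab(2)] by blast
      (* Jacobi for J a1, u, J w, where [J a1, J w] is J u modulo C i. *)
      have "br u (J u) \<in> C i"
      proof -
        have "br (J a1) (br u (J w)) = br (br (J a1) u) (J w) + br u (br (J a1) (J w))"
          by (rule jacobi)
        then have "br u (J u) = br (J a1) (br u (J w)) - br (br (J a1) u) (J w) - br u (br a1 w)"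
          unfolding a1w by (simp add: br_simps algebra_simps)
        also have "\<dots> \<in> C i"
          using cspan_superset[OF L(1)] u(1)
          by (intro C_closed C_ideal' C_ideal uJw JQW a1(1) C_SucD[OF a1(1)]) auto
        finally show ?thesis .
      qed
      moreover have "br u (J q') \<in> C i"
        using C_SucD'[OF q'(1), of "J u"] br_J[of u q'] Bu C_neg[of "br (J u) q'" i] by simp
      moreover have "br u q \<in> C i" using C_SucD'[OF q(1)] .
      ultimately show ?thesis
        unfolding s(2) ab(3) q(2) q'(2) J_simps br_simps
        by (intro C_closed uw uJw) simp_all
    qed
    then show False using u_Q C_SucI by blast
  qed
  obtain c d e f where cdef: "B a2 w = c *\<^sub>R a1 + d *\<^sub>R J a1 + e *\<^sub>R u + f *\<^sub>R J u"
  proof -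
    define z where "z = B a2 w"
    have z: "z \<in> S2" "J z \<in> S2"
      using B_cpart[OF S2(1,2) a2(1,3), of w] by (auto simp: cpart_def z_def)
    obtain z' d where z': "z' \<in> S1" "z = z' + d *\<^sub>R J a1"
      using adjoinE[OF z(1)[unfolded S2_def]] .
    obtain l f where l: "l \<in> L" "z' = l + f *\<^sub>R J u"
      using adjoinE[OF z'(1)[unfolded S1_def]] .
    have "J l = J z + d *\<^sub>R a1 + f *\<^sub>R u"
      by (simp add: z'(2) l(2) J_simps)
    moreover have "a1 \<in> S2" "u \<in> S2" using a1(1) u(1) L(2) S1(2) S2(2) by auto
    ultimately have "J l \<in> S2"
      using subspace_add[OF S2(1)] subspace_scale[OF S2(1)] z(2) by simp
    then obtain y c where y: "y \<in> S1" "J l = y + c *\<^sub>R J a1"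
      unfolding S2_def by (rule adjoinE)
    obtain l' e where l': "l' \<in> L" "y = l' + e *\<^sub>R J u"
      using adjoinE[OF y(1)[unfolded S1_def]] .
    have "J (l - c *\<^sub>R a1 - e *\<^sub>R u) \<in> L"
      using l' y(2) by (simp add: J_simps)
    then have "l - c *\<^sub>R a1 - e *\<^sub>R u = 0"
      using a1(1) L(2) by (intro trL L_closed l u) auto
    then have "l = c *\<^sub>R a1 + e *\<^sub>R u" by (simp add: algebra_simps)
    then have "z = c *\<^sub>R a1 + d *\<^sub>R J a1 + e *\<^sub>R u + f *\<^sub>R J u"
      using z'(2) l(2) by simp
    then show thesis using that unfolding z_def by blast
  qed
  (* The left side of Jacobi for J a2, w, J w lies in C i; the right side is r modulo C i. *)
  define r where "r = d *\<^sub>R J u - c *\<^sub>R u + f *\<^sub>R br u w + f *\<^sub>R br u w"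
  have r: "r \<in> C i"
  proof -
    have a2w: "br (J a2) w = B a2 w - br a2 (J w)" "br (J a2) (J w) = br a2 w + J (B a2 w)"
      by (rule br_J, rule br_JJ)
    have "br (J a2) (br w (J w)) = br (br (J a2) w) (J w) + br w (br (J a2) (J w))"
      by (rule jacobi)
    moreover have "br (J u) (J w) = br u w"
      by (simp add: br_JJ Bu J_simps)
    moreover have "br w (J a1) = br a1 (J w) - u"
      using a1w(1) br_swap[of w "J a1"] by simp
    moreover have "br w u = - br u w"
      by (rule br_swap)
    ultimately have "r = br (J a2) (br w (J w)) + br (br a2 (J w)) (J w) - br w (br a2 w)
        - c *\<^sub>R br a1 (J w) - d *\<^sub>R br a1 w - e *\<^sub>R br u (J w) - e *\<^sub>R br u (J w) - c *\<^sub>R br a1 (J w)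
        + d *\<^sub>R br w a1"
      unfolding a2w cdef r_def
      by (simp add: br_simps J_simps a1w wJu scaleR_2 algebra_simps)
    also have "\<dots> \<in> C i"
      by (intro C_closed JQW a2(1) kW C_ideal C_ideal' C_SucD[OF a1(1)] C_SucD[OF a2(1)]
          C_SucD'[OF a1(1)] uJw)
    finally show ?thesis .
  qed
  have rQ: "r \<in> C (Suc i)" using r C_step by blast
  have gQ: "br u w \<in> C (Suc i)" using brL[OF u(1)] .
  have "d *\<^sub>R J u = r + c *\<^sub>R u - f *\<^sub>R br u w - f *\<^sub>R br u w" by (simp add: r_def)
  also have "\<dots> \<in> L" using rQ gQ L(2) by (intro L_closed u(1)) auto
  finally have d: "d = 0"
    using u(2) subspace_scale[OF L(1), of "d *\<^sub>R J u" "inverse d"] by (cases "d = 0") auto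
  have "c *\<^sub>R u = f *\<^sub>R br u w + f *\<^sub>R br u w - r" using d by (simp add: r_def)
  also have "\<dots> \<in> C (Suc i)" by (intro C_closed rQ gQ)
  finally have c: "c = 0"
    using u_Q C_scale[of "c *\<^sub>R u" "Suc i" "inverse c"] by (cases "c = 0") auto
  have f: "f = 0"
    using r uw C_scale[of "(2 * f) *\<^sub>R br u w" i "inverse (2 * f)"] c d
    by (cases "f = 0") (auto simp: r_def scaleR_2[symmetric])
  define b where "b = a2 - e *\<^sub>R a1"
  have bQ: "b \<in> C (Suc i)" unfolding b_def by (intro C_closed a1(1) a2(1))
  have "B b w = 0"
    by (simp add: b_def B_simps cdef c d f w)
  moreover have "B b s = 0" if "s \<in> cspan L" for s
    using that by (auto simp: cspan_def B_simps B_J_right BQL[OF bQ] J_simps)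
  ultimately have "B b U = 0" for U
    by (rule B_zero_by_hyperplane[OF W dim_W6 w_W])
  then have "J b \<in> C (Suc i)" by (rule J_mem_of_B_zero[OF bQ])
  then have "J b \<in> S2" using L(2) S1(2) S2(2) by blast
  moreover have "J a2 = J b + e *\<^sub>R J a1" by (simp add: b_def J_simps)
  ultimately show False
    using a2(2) subspace_add[OF S2(1)] subspace_scale[OF S2(1)] S2(4) by metis
qed

lemma dim_totally_real_term:
  assumes "totally_real (C (Suc i))"
  shows "dim (C (Suc i)) \<le> 1"
  using totally_real_term_dim_less_3[OF assms] totally_real_term_dim_not_2[OF assms] by linarith

section \<open>How the dimensions determine the ascending type\<close>

lemma dim_step:
  assumes "dim (C k) < 8"
  shows "dim (C k) < dim (C (Suc k))"
proof -
  have "\<not> UNIV \<subseteq> C k"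
    using assms dim8 fd_dim_mono[OF fd, of UNIV "C k"] by auto
  then obtain t where "t \<notin> C k" "\<And>U. br t U \<in> C k"
    using engel[of UNIV "C k", OF UNIV_I C_0] by metis
  then have "t \<in> C (Suc k) - C k" using C_SucI by blast
  then have "C k \<subset> C (Suc k)" using C_step[of k] by blast
  then show ?thesis by (intro fd_dim_less fd subspace_C)
qed

text \<open>If \<open>C (k + 1)\<close> had codimension 1, a vector \<open>v\<close> outside it would commute with itself and
  bracket \<open>C (k + 1)\<close> into \<open>C k\<close>, so it would lie in \<open>C (k + 1)\<close> as well.\<close>

lemma dim_not_7: "dim (C (Suc k)) \<noteq> 7"
proof
  assume 7: "dim (C (Suc k)) = 7"
  then obtain v where v: "v \<notin> C (Suc k)"
    using dim8 by (metis UNIV_eq_I num.distinct(5) numeral_eq_iff semiring_norm(88))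
  have "adjoin (C (Suc k)) v = UNIV"
    using fd_subspace_eq[OF fd subspace_adjoin[OF subspace_C], of UNIV "Suc k" v]
      fd_dim_adjoin[OF fd subspace_C v] 7 dim8 by simp
  then have "U \<in> adjoin (C (Suc k)) v" for U by simp
  then have "br v U \<in> C k" for U
    using C_SucD'[of _ k v] by (metis adjoinE add_0_right bilinear_radd[OF bil]
        bilinear_rmul[OF bil] br_self scaleR_zero_right)
  then show False using v C_SucI by blast
qed

lemma dim_le_8: "dim (C k) \<le> 8"
  using fd_dim_mono[OF fd, of "C k" UNIV] dim8 by simp

lemma type_if_last:
  assumes "dim (C (Suc k)) = 8" "dim (C k) < 8"
  shows "ascending_type br = map (\<lambda>k. dim (C k)) [1..<Suc (Suc k)]"
proof -
  have UN: "C (Suc k) = UNIV"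
    using fd_subspace_eq[OF fd subspace_C subspace_UNIV] assms(1) dim8 by simp
  have "nilpotency_step br = Suc k"
    unfolding nilpotency_step_def
  proof (rule Least_equality)
    fix s assume s: "1 \<le> s \<and> C s = UNIV"
    show "Suc k \<le> s"
    proof (rule ccontr)
      assume "\<not> Suc k \<le> s"
      then have "C s \<subseteq> C k" by (intro C_mono) simp
      then have "C k = UNIV" using s by blast
      then show False using assms(2) dim8 by simp
    qed
  qed (use UN in simp)
  then show ?thesis by (simp add: ascending_type_def)
qed

end

section \<open>Strongly non-nilpotent complex structures\<close>

locale snn_complex = nilpotent_complex +
  assumes snn: "strongly_non_nilpotent br J"
begin

abbreviation C1 :: "'a set" where "C1 \<equiv> C (Suc 0)"
abbreviation C2 :: "'a set" where "C2 \<equiv> C (Suc (Suc 0))"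
abbreviation C3 :: "'a set" where "C3 \<equiv> C (Suc (Suc (Suc 0)))"

lemma centre_totally_real: "totally_real C1"
proof -
  have "v \<in> a\<^sub>1 br J" if "v \<in> C1" "J v \<in> C1" for v
    using that by (simp add: a\<^sub>1_def ascending_central_series.simps)
  then show ?thesis
    using snn by (auto simp: totally_real_def strongly_non_nilpotent_def)
qed

lemma dim_C1: "dim C1 = 1"
proof -
  have "dim (C 0) < dim C1"
    using dim_step[of 0] by (simp add: dim_zero)
  then show ?thesis
    using dim_totally_real_term[OF centre_totally_real] by linarith
qed

lemma J_centre:
  assumes "z \<in> C1" "z \<noteq> 0"
  shows "J z \<notin> C2"
  using totally_real_step[OF centre_totally_real assms(1)] assms(2) by blast

lemma B_centre: "z \<in> C1 \<Longrightarrow> B z U = br (J z) U"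
  using C_SucD[of z 0 "J U"] by (simp add: B_def)

lemma centre_line:
  assumes "z \<in> C1" "z \<noteq> 0" "v \<in> C1"
  obtains c where "v = c *\<^sub>R z"
proof -
  have "dim (adjoin {0} z) = 1"
    using fd_dim_adjoin[OF fd subspace_single_0, of z] assms(2) by (simp add: dim_zero)
  moreover have "adjoin {0} z \<subseteq> C1"
    by (intro adjoin_least subspace_C assms(1)) simp
  ultimately have "adjoin {0} z = C1"
    using fd_subspace_eq[OF fd subspace_adjoin[OF subspace_single_0] subspace_C] dim_C1 by simp
  then show thesis
    using that assms(3) by (auto simp: adjoin_def)
qed

lemma centre_nonzero: obtains x where "x \<in> C1" "x \<noteq> 0"
proof -
  have "\<not> C1 \<subseteq> {0}"
    using dim_C1 fd_dim_mono[OF fd, of C1 "{0}"] by (auto simp: dim_zero)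
  then show thesis using that by blast
qed

text \<open>The value lies in the centre, say it is \<open>c z\<close>. Then \<open>[J z, J v] = c J z\<close>, so \<open>J z\<close> would be
  an eigenvector of \<open>ad (J v)\<close> unless \<open>c = 0\<close>.\<close>

lemma B_centre_C2:
  assumes z: "z \<in> C1" and v: "v \<in> C2"
  shows "B z v = 0"
proof (cases "z = 0")
  case True
  then show ?thesis by (simp add: B_simps)
next
  case False
  have "B z v \<in> C1"
    unfolding B_centre[OF z] by (rule C_SucD'[OF v])
  then obtain c where c: "B z v = c *\<^sub>R z"
    using centre_line[OF z False] by metis
  show ?thesis
  proof (rule ccontr)
    assume "B z v \<noteq> 0"
    then have "c \<noteq> 0" using c by auto
    then have "br (J z) (inverse c *\<^sub>R J v) = J z"
      unfolding B_centre[OF z, symmetric] B_simps B_J_right c by (simp add: J_simps)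
    then have "J z \<in> {0}"
      using no_eigenvector[of "{0}" "inverse c *\<^sub>R J v" "J z"] by (simp add: br_simps)
    then have "J z \<in> C2" using C_0 by simp
    then show False using J_centre[OF z False] by simp
  qed
qed

text \<open>The values of \<open>B e\<close> form a complex subspace of the totally real centre.\<close>

lemma cpart_C2_central:
  assumes "e \<in> cpart C2"
  shows "B e U = 0"
proof -
  have e: "e \<in> C2" "J e \<in> C2" using assms by (auto simp: cpart_def)
  have "B e X \<in> C1" for X
    unfolding B_def by (intro C_add C_SucD e)
  from this[of U] this[of "J U"] show ?thesis
    using centre_totally_real by (simp add: B_J_right totally_real_def)
qed

lemma centre_cpart_C2: "v \<in> C1 \<Longrightarrow> v \<in> cpart C2 \<Longrightarrow> v = 0"
  using J_centre by (auto simp: cpart_def)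

text \<open>The complex part is nonzero because \<open>C 2\<close> is too large to be totally real, and proper because
  it meets the centre trivially.\<close>

lemma dim_cpart_C2: "2 \<le> dim (cpart C2)" "dim (cpart C2) < dim C2"
proof -
  have "2 \<le> dim C2" using dim_step[of "Suc 0"] dim_C1 by simp
  then have "\<not> totally_real C2" using dim_totally_real_term[of "Suc 0"] by auto
  then obtain v where v: "v \<in> cpart C2" "v \<noteq> 0" by (auto simp: totally_real_def cpart_def)
  note cp = csubspace_cpart[OF subspace_C[of "Suc (Suc 0)"]]
  have "adjoin {0} v \<subseteq> cpart C2"
    using subspace_0[OF csubspaceD(1)[OF cp]] v(1) by (intro adjoin_least csubspaceD(1)[OF cp]) auto
  moreover have "dim (adjoin {0} v) = 1"
    using fd_dim_adjoin[OF fd subspace_single_0, of v] v(2) by (simp add: dim_zero)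
  ultimately have "1 \<le> dim (cpart C2)"
    using fd_dim_mono[OF fd] by metis
  then show "2 \<le> dim (cpart C2)"
    using even_gap[OF even_dim_csubspace[OF cp], of 0] by simp
  obtain x where x: "x \<in> C1" "x \<noteq> 0" by (rule centre_nonzero)
  then have "x \<in> C2 - cpart C2"
    using C_step centre_cpart_C2 by blast
  then show "dim (cpart C2) < dim C2"
    using cpart_subset[of C2] by (intro fd_dim_less[OF fd csubspaceD(1)[OF cp] subspace_C]) blast
qed

lemma cspan_C2_proper: "cspan C2 \<noteq> UNIV"
proof
  assume UN: "cspan C2 = UNIV"
  obtain x where x: "x \<in> C1" "x \<noteq> 0" by (rule centre_nonzero)
  have "B x U = 0" for U
  proof -
    obtain a b where ab: "a \<in> C2" "b \<in> C2" "U = a + J b"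
      using cspanE[of U C2] UN by blast
    then show ?thesis using B_centre_C2[OF x(1)] by (simp add: B_simps B_J_right J_simps)
  qed
  then have "J x \<in> C1" by (rule J_mem_of_B_zero[OF x(1)])
  then show False using J_centre[OF x] C_step by blast
qed

lemma dim_cspan_C2: "dim C2 < dim (cspan C2)" "dim (cspan C2) \<le> 6"
proof -
  obtain x where x: "x \<in> C1" "x \<noteq> 0" by (rule centre_nonzero)
  note W = csubspace_cspan[OF subspace_C[of "Suc (Suc 0)"]]
  have "J x \<in> cspan C2 - C2"
    using J_centre[OF x] J_cspan[OF subspace_C] C_step x(1) by blast
  then show "dim C2 < dim (cspan C2)"
    using cspan_superset[OF subspace_C] by (intro fd_dim_less[OF fd subspace_C csubspaceD(1)[OF W]]) blast
  have "dim (cspan C2) < 8"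
    using fd_dim_less[OF fd csubspaceD(1)[OF W] subspace_UNIV] cspan_C2_proper dim8
    by (simp add: psubset_eq)
  then show "dim (cspan C2) \<le> 6"
    using even_gap(2)[OF even_dim_csubspace[OF W], of 8] by simp
qed

lemma dim_C2: "3 \<le> dim C2" "dim C2 \<le> 5"
  using dim_cpart_C2 dim_cspan_C2 by linarith+

text \<open>Here \<open>W = C 2 + J (C 2)\<close> is a complex hyperplane and \<open>B\<close> vanishes on it. A first vector
  \<open>J a\<close> of \<open>C 3\<close> outside \<open>C 2\<close> comes from Engel's theorem on \<open>W / C 2\<close>, and \<open>B a\<close> takes values in the
  complex part \<open>E\<close> of \<open>C 2\<close>. The next step of the flag gives \<open>J b\<close> with
  \<open>B b w = e + d a + c J a\<close>, \<open>e \<in> E\<close>. The Jacobi identity for \<open>J b\<close>, \<open>w\<close>, \<open>J w\<close> modulo the centre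
  reduces to \<open>c J (B a w) = d (B a w)\<close>. Since \<open>B a w \<noteq> 0\<close>, both \<open>c\<close> and \<open>d\<close> vanish, and \<open>J b\<close> is a
  second vector of \<open>C 3\<close>.\<close>

lemma dim_C3_if_dim_C2_eq_4:
  assumes 4: "dim C2 = 4"
  shows "6 \<le> dim C3"
proof -
  obtain x where x: "x \<in> C1" "x \<noteq> 0" by (rule centre_nonzero)
  have xC2: "x \<in> C2" using x(1) C_step by blast
  note E = csubspace_cpart[OF subspace_C[of "Suc (Suc 0)"]]
  note W = csubspace_cspan[OF subspace_C[of "Suc (Suc 0)"]]
  have dim_W: "6 \<le> dim (cspan C2)"
    using dim_cspan_C2(1) even_gap(1)[OF even_dim_csubspace[OF W], of 4] 4 by simp
  have dim_E: "dim (cpart C2) = 2"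
    using dim_cpart_C2 even_gap(2)[OF even_dim_csubspace[OF E], of 4] 4 by simp
  have W_ideal: "br v U \<in> cspan C2" if "v \<in> cspan C2" for v U
    by (rule cspan_ideal[OF subspace_C C_ideal dim_W that])
  have BC: "B b b' = 0" if b: "b \<in> C2" "b' \<in> C2" for b b'
  proof -
    (* C2 is spanned by the complex part, x and one more vector b0. The first two are annihilated
       by B on C2, and B b0 b0 = 0. *)
    define F where "F = adjoin (cpart C2) x"
    have "x \<notin> cpart C2" using centre_cpart_C2 x by blast
    then have "dim F = 3"
      unfolding F_def using fd_dim_adjoin[OF fd csubspaceD(1)[OF E]] dim_E by simp
    moreover have "subspace F" "F \<subseteq> C2"
      unfolding F_def
      by (intro subspace_adjoin csubspaceD(1)[OF E] adjoin_least subspace_C cpart_subset xC2)+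
    ultimately have F: "subspace F" "dim F = 3" "F \<subseteq> C2" by blast+
    have "\<not> C2 \<subseteq> F" using fd_dim_mono[OF fd, of C2 F] F(2) 4 by auto
    then obtain b0 where b0: "b0 \<in> C2" "b0 \<notin> F" by blast
    have C2_eq: "adjoin F b0 = C2"
      using fd_dim_adjoin[OF fd F(1) b0(2)] F(2) 4
      by (intro fd_subspace_eq fd subspace_adjoin F(1) subspace_C adjoin_least F(3) b0(1)) simp
    have dec: "\<exists>e\<in>cpart C2. \<exists>c d. v = e + c *\<^sub>R x + d *\<^sub>R b0" if "v \<in> C2" for v
      using that[folded C2_eq] by (fastforce simp: F_def adjoin_def)
    have B0: "B e U = 0" "B U e = 0" if "e \<in> cpart C2" for e U
      using cpart_C2_central[OF that] B_swap[of U e] by simp_all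
    have Bx: "B x v = 0" "B v x = 0" if "v \<in> C2" for v
      using B_centre_C2[OF x(1) that] B_swap[of v x] by simp_all
    obtain e c d where e: "e \<in> cpart C2" "b = e + c *\<^sub>R x + d *\<^sub>R b0" using dec[OF b(1)] by blast
    obtain e' c' d' where e': "e' \<in> cpart C2" "b' = e' + c' *\<^sub>R x + d' *\<^sub>R b0"
      using dec[OF b(2)] by blast
    show ?thesis
      unfolding e(2) e'(2) B_simps B0(1)[OF e(1)] B0(2)[OF e'(1)] Bx(1)[OF b0(1)] Bx(2)[OF b0(1)]
      by simp
  qed
  have "\<not> cspan C2 \<subseteq> C2"
    using fd_dim_mono[OF fd, of "cspan C2" C2] dim_cspan_C2(1) by linarith
  then obtain a where a: "a \<in> C2" "J a \<notin> C2" "\<And>U. br (J a) U \<in> C2"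
    using engel_imaginary[OF subspace_C C_ideal W_ideal subspace_C order_refl] by metis
  have Ja: "J a \<in> C3" by (rule C_SucI[OF a(3)])
  have Ba: "B a U \<in> cpart C2" for U by (rule B_in_cpart[OF a(1) Ja])
  define S where "S = adjoin C2 (J a)"
  have S: "subspace S" "C2 \<subseteq> S" "dim S = 5" "J a \<in> S" "S \<subseteq> C3"
    unfolding S_def using fd_dim_adjoin[OF fd subspace_C a(2)] 4
      subspace_adjoin[OF subspace_C] subset_adjoin adjoin_self[OF subspace_C]
      adjoin_least[OF subspace_C C_step Ja] by simp_all
  have "\<not> cspan C2 \<subseteq> S"
    using fd_dim_mono[OF fd, of "cspan C2" S] dim_W S(3) by linarith
  then obtain b where b: "b \<in> C2" "J b \<notin> S" "\<And>U. br (J b) U \<in> S"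
    using engel_imaginary[OF subspace_C C_ideal W_ideal S(1,2)] by metis
  obtain w where w: "w \<notin> cspan C2" using cspan_C2_proper by blast
  have kW: "br w (J w) \<in> cspan C2"
    by (rule derived_in_hyperplane[OF W dim_W W_ideal])
  obtain e c d where e: "e \<in> cpart C2" and Bbw: "B b w = e + d *\<^sub>R a + c *\<^sub>R J a"
  proof -
    have BS: "B b X \<in> S" for X
      unfolding B_def using C_ideal[OF b(1)] S(2) by (intro subspace_add[OF S(1)] b(3)) blast
    have z: "B b w \<in> S" "J (B b w) \<in> S"
      using BS[of w] BS[of "J w"] by (simp_all add: B_J_right)
    obtain p c where p: "p \<in> C2" "B b w = p + c *\<^sub>R J a"
      using adjoinE[OF z(1)[unfolded S_def]] .
    have "J p = J (B b w) + c *\<^sub>R a" by (simp add: p(2) J_simps)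
    then have "J p \<in> S"
      using a(1) S(2) subspace_add[OF S(1) z(2)] subspace_scale[OF S(1)] by auto
    then obtain p' d where p': "p' \<in> C2" "J p = p' + d *\<^sub>R J a"
      unfolding S_def by (rule adjoinE)
    have "J (p - d *\<^sub>R a) = p'" by (simp add: J_simps p'(2))
    moreover have "p - d *\<^sub>R a \<in> C2" by (intro C_closed p(1) a(1))
    ultimately have "p - d *\<^sub>R a \<in> cpart C2" using p'(1) by (simp add: cpart_def)
    moreover have "B b w = (p - d *\<^sub>R a) + d *\<^sub>R a + c *\<^sub>R J a" using p(2) by simp
    ultimately show thesis by (rule that)
  qed
  have e2: "e \<in> C2" "J e \<in> C2" using e by (auto simp: cpart_def)
  (* r is the only part of Jacobi for J b, w, J w that is not visibly central. *)
  define r where "r = c *\<^sub>R J (B a w) - d *\<^sub>R B a w"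
  have "r \<in> C1"
  proof -
    have bw: "br (J b) w = B b w - br b (J w)" "br (J b) (J w) = br b w + J (B b w)"
      by (rule br_J, rule br_JJ)
    have aw: "br (J a) (J w) = br a w + J (B a w)" "br w (J a) = br a (J w) - B a w"
      "br w a = - br a w"
      using br_J[of a w] br_swap[of w "J a"] br_swap[of w a] by (simp_all add: br_JJ)
    have "br (J b) (br w (J w)) = br (br (J b) w) (J w) + br w (br (J b) (J w))"
      by (rule jacobi)
    then have "r = br (J b) (br w (J w)) - br e (J w) - br w (J e) - d *\<^sub>R br a (J w) - d *\<^sub>R br a (J w)
        - c *\<^sub>R br a w - c *\<^sub>R br a w + br (br b (J w)) (J w) - br w (br b w)"
      unfolding bw Bbw r_def by (simp add: br_simps J_simps aw algebra_simps)
    also have "\<dots> \<in> C1"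
    proof -
      obtain p q where p: "p \<in> C2" "q \<in> C2" "br w (J w) = p + J q" using cspanE[OF kW] .
      have "br (J b) (br w (J w)) \<in> C1"
        unfolding p(3) br_simps br_JJ BC[OF b(1) p(2)] J_simps add_0_right
        by (intro C_closed C_SucD C_SucD' b(1) p(1))
      then show ?thesis
        by (intro C_closed C_SucD[OF a(1)] C_SucD[OF e2(1)] C_SucD'[OF e2(2)]
            C_ideal[OF C_SucD[OF b(1)]] C_ideal'[OF C_SucD[OF b(1)]])
    qed
    finally show ?thesis .
  qed
  moreover have "r \<in> cpart C2"
    unfolding r_def
    by (intro subspace_diff subspace_scale csubspaceD(1)[OF E] csubspaceD(2)[OF E] Ba)
  ultimately have r: "(- d) *\<^sub>R B a w + c *\<^sub>R J (B a w) = 0"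
    using centre_cpart_C2[of r] by (simp add: r_def)
  have "B a w \<noteq> 0"
  proof
    assume "B a w = 0"
    moreover have "B a s = 0" if "s \<in> cspan C2" for s
      using that by (auto simp: cspan_def B_simps B_J_right BC[OF a(1)] J_simps)
    ultimately have "B a U = 0" for U
      by (rule B_zero_by_hyperplane[OF W dim_W w])
    then show False
      using J_mem_of_B_zero[OF a(1)] a(2) by blast
  qed
  then have "c = 0" "d = 0" using complex_scale_eq_0[OF r] by auto
  then have Bbw': "B b w = e" using Bbw by simp
  have "br (J b) U \<in> C2" for U
  proof -
    obtain s c d where s: "s \<in> cspan C2" "U = s + c *\<^sub>R w + d *\<^sub>R J w"
      using complex_complement[OF W dim_W w] .
    have "B b s = 0"
      using s(1) by (auto simp: cspan_def B_simps B_J_right BC[OF b(1)] J_simps)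
    then have "B b U = c *\<^sub>R e + d *\<^sub>R J e"
      by (simp add: s(2) B_simps B_J_right Bbw')
    then show ?thesis
      unfolding br_J using e2 C_ideal[OF b(1)] by (intro C_closed) (simp only: C_closed)+
  qed
  then have "J b \<in> C3" by (rule C_SucI)
  then have "adjoin S (J b) \<subseteq> C3" by (intro adjoin_least subspace_C S(5))
  then show ?thesis
    using fd_dim_mono[OF fd, of "adjoin S (J b)" C3] fd_dim_adjoin[OF fd S(1) b(2)] S(3) by simp
qed

text \<open>Let \<open>E\<close> be the complex part of \<open>C 2\<close>, so that \<open>C 2\<close> is \<open>E\<close> plus the centre, which is
  spanned by \<open>x\<close>, and suppose that \<open>C 3\<close> has dimension 4.

  If \<open>J x \<notin> C 3\<close>, then \<open>C 3\<close> has complex part \<open>E\<close> and spans a complex subspace of dimension at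
  least 6. Engel's theorem gives \<open>b \<in> C 3\<close> with \<open>J b\<close> in \<open>C 4\<close> but not in \<open>C 3\<close>. Then \<open>B b\<close> has
  values in \<open>E\<close>, so the brackets of \<open>J b\<close> lie in \<open>C 2\<close>, a contradiction.

  If \<open>J x \<in> C 3\<close>, then \<open>C 3\<close> is the complex span of \<open>E\<close> and \<open>x\<close>, and \<open>ad (J x) = B x\<close> maps onto \<open>E\<close>
  with kernel a complex hyperplane \<open>P\<close>. This \<open>P\<close> is an ideal that centralizes \<open>C 3\<close> and has all its
  brackets in \<open>C 3\<close>. Let \<open>w \<notin> P\<close> and \<open>k = [w, J w] \<in> P\<close>. The Jacobi identity for \<open>q \<in> P\<close>, \<open>w\<close>, \<open>J w\<close>
  shows that \<open>[q, k] = 0\<close> implies \<open>q \<in> C 3\<close>. Taking \<open>q = k\<close> gives \<open>k \<in> C 3\<close>; then \<open>[q, k] = 0\<close> for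
  all \<open>q \<in> P\<close>, which makes \<open>P\<close> a subset of \<open>C 3\<close>.\<close>

lemma dim_C3_not_4:
  assumes 3: "dim C2 = 3"
  shows "dim C3 \<noteq> 4"
proof
  assume 4: "dim C3 = 4"
  obtain x where x: "x \<in> C1" "x \<noteq> 0" by (rule centre_nonzero)
  have xC2: "x \<in> C2" and xC3: "x \<in> C3" using x(1) C_step by blast+
  define E where "E = cpart C2"
  have E: "csubspace E" unfolding E_def by (rule csubspace_cpart[OF subspace_C])
  have E_C2: "E \<subseteq> C2" unfolding E_def by (rule cpart_subset)
  have dim_E: "dim E = 2"
    using dim_cpart_C2 even_gap(2)[OF even_dim_csubspace[OF E], of 4] 3 unfolding E_def by simp
  have x_E: "x \<notin> E" using centre_cpart_C2 x unfolding E_def by blast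
  have C1_E: "v = 0" if "v \<in> C1" "v \<in> E" for v
    using that centre_cpart_C2 unfolding E_def by blast
  show False
  proof (cases "J x \<in> C3")
    case False
    define W where "W = cspan C3"
    have W: "csubspace W" unfolding W_def by (rule csubspace_cspan[OF subspace_C])
    have "C3 \<subset> W"
      using cspan_superset[OF subspace_C] J_cspan[OF subspace_C xC3] False unfolding W_def by blast
    then have "4 < dim W"
      using fd_dim_less[OF fd subspace_C csubspaceD(1)[OF W]] 4 by metis
    then have dim_W: "6 \<le> dim (cspan C3)"
      using even_gap(1)[OF even_dim_csubspace[OF W], of 4] unfolding W_def by simp
    have "\<not> cspan C3 \<subseteq> C3" using \<open>C3 \<subset> W\<close> unfolding W_def by blast
    then obtain b where b: "b \<in> C3" "J b \<notin> C3" "\<And>U. br (J b) U \<in> C3"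
      using engel_imaginary[OF subspace_C C_ideal cspan_ideal[OF subspace_C C_ideal dim_W] subspace_C
          order_refl] by metis
    have cp: "csubspace (cpart C3)" by (rule csubspace_cpart[OF subspace_C])
    have "cpart C3 \<subset> C3" using False xC3 by (auto simp: cpart_def)
    then have "dim (cpart C3) < 4"
      using fd_dim_less[OF fd csubspaceD(1)[OF cp] subspace_C] 4 by metis
    then have "dim (cpart C3) \<le> dim E"
      using even_gap(2)[OF even_dim_csubspace[OF cp], of 4] dim_E by simp
    moreover have "E \<subseteq> cpart C3" unfolding E_def by (intro cpart_mono C_step)
    ultimately have cp_E: "cpart C3 = E"
      using fd_subspace_eq[OF fd csubspaceD(1)[OF E] csubspaceD(1)[OF cp]] by simp
    have "br (J b) U \<in> C2" for U
      using B_in_cpart[OF b(1) C_SucI[OF b(3)], of U] C_SucD[OF b(1), of "J U"] E_C2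
        C_diff unfolding br_J cp_E by blast
    then have "J b \<in> C3" by (rule C_SucI)
    then show False using b(2) by contradiction
  next
    case True
    have C3_eq: "cadjoin E x = C3"
    proof (rule fd_subspace_eq[OF fd csubspaceD(1)[OF csubspace_cadjoin[OF E]] subspace_C])
      show "cadjoin E x \<subseteq> C3"
        unfolding cadjoin_def using E_C2 C_step by (intro adjoin_least subspace_C xC3 True) blast
      show "dim C3 \<le> dim (cadjoin E x)"
        using dim_cadjoin[OF E x_E] dim_E 4 by simp
    qed
    have C3: "csubspace C3" using csubspace_cadjoin[OF E, of x] unfolding C3_eq .
    have C3_cases: "\<exists>e\<in>E. \<exists>c d. v = e + c *\<^sub>R x + d *\<^sub>R J x" if "v \<in> C3" for v
      using that[folded C3_eq] cadjoinE by metis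
    have Jx: "br (J x) U = B x U" for U by (simp only: B_centre[OF x(1)])
    have brx: "br x U = 0" "br U x = 0" for U
      using C_SucD[OF x(1), of U] C_SucD'[OF x(1), of U] by simp_all
    have A_E: "B x U \<in> E" for U
      unfolding E_def by (rule B_in_cpart[OF xC2 True])
    have A_C3: "B x v = 0" if "v \<in> C3" for v
    proof -
      obtain e c d where "e \<in> E" "v = e + c *\<^sub>R x + d *\<^sub>R J x" using C3_cases[OF \<open>v \<in> C3\<close>] by blast
      moreover from this have "B x e = 0" using B_centre_C2[OF x(1)] E_C2 by blast
      ultimately show ?thesis by (simp add: B_simps B_J_right J_simps)
    qed
    obtain w where w: "B x w \<noteq> 0"
      using J_mem_of_B_zero[OF x(1)] J_centre[OF x] C_step by blast
    define y where "y = B x w"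
    have y: "y \<noteq> 0" "y \<in> E" "J y \<in> E" "y \<in> C2" "J y \<in> C2"
      using w A_E[of w] csubspaceD(2)[OF E] E_C2 unfolding y_def by blast+
    have E_eq: "cadjoin {0} y = E"
    proof (rule fd_subspace_eq[OF fd csubspaceD(1)[OF csubspace_cadjoin[OF csubspace_0]]
          csubspaceD(1)[OF E]])
      show "cadjoin {0} y \<subseteq> E"
        using subspace_0[OF csubspaceD(1)[OF E]] y(2) by (intro cadjoin_least E) auto
      show "dim E \<le> dim (cadjoin {0} y)"
        using dim_cadjoin[OF csubspace_0, of y] y(1) dim_E by simp
    qed
    have E_cases: "\<exists>c d. e = c *\<^sub>R y + d *\<^sub>R J y" if "e \<in> E" for e
      using that[folded E_eq] cadjoinE by (metis add_0 singletonD)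
    define P where "P = {U. B x U = 0}"
    have P: "csubspace P"
      unfolding P_def csubspace_def subspace_def by (auto simp: B_simps B_J_right J_simps)
    have C3_P: "C3 \<subseteq> P" using A_C3 unfolding P_def by blast
    have w_P: "w \<notin> P" using w unfolding P_def by simp
    have V_cases: "\<exists>p\<in>P. \<exists>c d. U = p + c *\<^sub>R w + d *\<^sub>R J w" for U
    proof -
      obtain c d where cd: "B x U = c *\<^sub>R y + d *\<^sub>R J y" using E_cases[OF A_E] by blast
      have "U - c *\<^sub>R w - d *\<^sub>R J w \<in> P"
        unfolding P_def by (simp add: B_simps B_J_right cd y_def[symmetric])
      moreover have "U = (U - c *\<^sub>R w - d *\<^sub>R J w) + c *\<^sub>R w + d *\<^sub>R J w" by simp
      ultimately show ?thesis by blast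
    qed
    have P_key: "B x (br p U) = 0" "br p (B x U) = 0" if p: "p \<in> P" for p U
    proof -
      have "B x (br p U) = br p (B x U)"
        using jacobi[of "J x" p U] p unfolding Jx P_def by (simp add: br_simps)
      moreover have "br p (B x U) \<in> C1"
        using A_E[of U] E_C2 by (intro C_SucD') blast
      ultimately show "B x (br p U) = 0" "br p (B x U) = 0"
        using C1_E[of "B x (br p U)"] A_E[of "br p U"] by simp_all
    qed
    have P_ideal: "br p U \<in> P" if "p \<in> P" for p U
      using P_key(1)[OF that] unfolding P_def by simp
    have P_C3: "br p v = 0" if p: "p \<in> P" and v: "v \<in> C3" for p v
    proof -
      obtain e c d where e: "e \<in> E" "v = e + c *\<^sub>R x + d *\<^sub>R J x" using C3_cases[OF v] by blast
      obtain c' d' where e': "e = c' *\<^sub>R y + d' *\<^sub>R J y" using E_cases[OF e(1)] by blast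
      have "br p y = 0" "br p (J y) = 0"
        using P_key(2)[OF p, of w] P_key(2)[OF p, of "J w"] by (simp_all add: y_def B_J_right)
      moreover have "br p (J x) = 0"
        using br_swap[of p "J x"] Jx p unfolding P_def by simp
      ultimately show ?thesis
        by (simp add: e(2) e' br_simps brx)
    qed
    define k where "k = br w (J w)"
    have k_P: "k \<in> P"
    proof -
      have "B x k = br y (J w) + br w (J y)"
        using jacobi[of "J x" w "J w"] unfolding Jx k_def B_J_right y_def by simp
      moreover have "br y (J w) + br w (J y) \<in> C1"
        by (intro C_closed C_SucD[OF y(4)] C_SucD'[OF y(5)])
      ultimately have "B x k = 0" using C1_E A_E by metis
      then show ?thesis unfolding P_def by simp
    qed
    have w_C3: "w \<notin> C3" using C3_P w_P by blast
    have "\<not> P \<subseteq> C3"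
    proof
      assume "P \<subseteq> C3"
      then have "cadjoin C3 w = UNIV"
        using V_cases cadjoinI by (metis UNIV_eq_I subsetD)
      then show False
        using dim_cadjoin[OF C3 w_C3] 4 dim8 by simp
    qed
    then obtain p where p: "p \<in> P" "p \<notin> C3" "\<And>U. br p U \<in> C3"
      using engel[of P C3, OF P_ideal C_0] by metis
    have P_eq: "cadjoin C3 p = P"
    proof (rule fd_subspace_eq[OF fd csubspaceD(1)[OF csubspace_cadjoin[OF C3]] csubspaceD(1)[OF P]])
      show "cadjoin C3 p \<subseteq> P" by (intro cadjoin_least P C3_P p(1))
      have "dim P + 2 \<le> 8"
        using dim_cadjoin[OF P w_P] fd_dim_mono[OF fd, of "cadjoin P w" UNIV] dim8 by simp
      then show "dim P \<le> dim (cadjoin C3 p)"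
        using dim_cadjoin[OF C3 p(2)] 4 by simp
    qed
    have P_cases: "\<exists>s\<in>C3. \<exists>c d. q = s + c *\<^sub>R p + d *\<^sub>R J p" if "q \<in> P" for q
      using that[folded P_eq] cadjoinE by metis
    (* Otherwise B p U is a nonzero complex multiple of p modulo C3; rescaling U turns that multiple
       into J p, and J p becomes an eigenvector on the quotient by C3. *)
    have Jp: "br (J p) U \<in> C3" for U
    proof (rule ccontr)
      assume U: "br (J p) U \<notin> C3"
      have "B p U \<in> P"
        unfolding B_def using subspace_add[OF csubspaceD(1)[OF P]] P_ideal p(1) csubspaceD(2)[OF P] by blast
      then obtain s c d where s: "s \<in> C3" "B p U = s + c *\<^sub>R p + d *\<^sub>R J p"
        using P_cases by blast
      have "B p U \<notin> C3"
        using U p(3)[of "J U"] C_diff[of "B p U"] unfolding br_J by blast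
      then have n: "c * c + d * d \<noteq> 0"
        using s by (auto simp: sum_squares_eq_zero_iff)
      define n where "n = inverse (c * c + d * d)"
      define U' where "U' = n *\<^sub>R (d *\<^sub>R U + c *\<^sub>R J U)"
      have "B p U' = n *\<^sub>R (d *\<^sub>R s + c *\<^sub>R J s) + (n * (c * c + d * d)) *\<^sub>R J p"
        by (simp add: U'_def B_simps B_J_right s(2) J_simps algebra_simps)
      then have "br (J p) U' - J p = n *\<^sub>R (d *\<^sub>R s + c *\<^sub>R J s) - br p (J U')"
        using n by (simp add: br_J n_def)
      also have "\<dots> \<in> C3"
        using p(3) csubspaceD(2)[OF C3 s(1)] s(1) by (intro C_closed)
      finally have "J p \<in> C3"
        using no_eigenvector[OF subspace_C C_ideal] by blast
      then show False using csubspaceD(3)[OF C3] p(2) by blast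
    qed
    have PV: "br q U \<in> C3" if q: "q \<in> P" for q U
    proof -
      obtain s c d where s: "s \<in> C3" "q = s + c *\<^sub>R p + d *\<^sub>R J p" using P_cases[OF q] by blast
      show ?thesis
        unfolding s(2) br_simps by (intro C_closed C_ideal[OF s(1)] p(3) Jp)
    qed
    (* [q, q'] lies in C3 and commutes with w, which forces its J x component to vanish. *)
    have PP: "br q q' \<in> C2" if q: "q \<in> P" "q' \<in> P" for q q'
    proof -
      have "br q (br q' w) = br (br q q') w + br q' (br q w)" by (rule jacobi)
      then have 0: "br (br q q') w = 0"
        using P_C3 PV q by simp
      obtain e c d where e: "e \<in> E" "br q q' = e + c *\<^sub>R x + d *\<^sub>R J x"
        using C3_cases[OF PV[OF q(1)]] by blast
      have "d *\<^sub>R y = - br e w"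
        using 0 unfolding e(2) by (simp add: br_simps brx Jx y_def[symmetric] eq_neg_iff_add_eq_0 add.commute)
      moreover have "br e w \<in> C1" using e(1) E_C2 by (intro C_SucD) blast
      ultimately have "d *\<^sub>R y = 0"
        using C1_E C_neg subspace_scale[OF csubspaceD(1)[OF E] y(2)] by metis
      then have "br q q' = e + c *\<^sub>R x" using y(1) e(2) by simp
      then show ?thesis using e(1) E_C2 xC2 C_closed by (metis subsetD)
    qed
    have key: "q \<in> C3" if q: "q \<in> P" and qk: "br q k = 0" for q
    proof -
      obtain e c d where e: "e \<in> E" "br q w = e + c *\<^sub>R x + d *\<^sub>R J x"
        using C3_cases[OF PV[OF q]] by blast
      obtain e' c' d' where e': "e' \<in> E" "br q (J w) = e' + c' *\<^sub>R x + d' *\<^sub>R J x"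
        using C3_cases[OF PV[OF q]] by blast
      have ee: "e \<in> C2" "e' \<in> C2" using e(1) e'(1) E_C2 by blast+
      (* d and d' are the J x components of [q, w] and [q, J w]; Jacobi compares them modulo the
         centre, which meets E trivially. *)
      have wJx: "br w (J x) = - y" using br_swap[of w "J x"] Jx y_def by simp
      have "0 = br e (J w) + d *\<^sub>R J y + (br w e' - d' *\<^sub>R y)"
        using jacobi[of q w "J w"] qk unfolding e(2) e'(2) k_def[symmetric]
        by (simp add: br_simps brx Jx wJx B_J_right y_def[symmetric])
      then have "(- d') *\<^sub>R y + d *\<^sub>R J y = - br e (J w) - br w e'"
        by (simp add: algebra_simps)
      moreover have "- br e (J w) - br w e' \<in> C1"
        by (intro C_closed C_SucD[OF ee(1)] C_SucD'[OF ee(2)])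
      moreover have "(- d') *\<^sub>R y + d *\<^sub>R J y \<in> E"
        by (intro subspace_add subspace_scale csubspaceD(1)[OF E] y)
      ultimately have 0: "(- d') *\<^sub>R y + d *\<^sub>R J y = 0" using C1_E by metis
      then have "d = 0" "d' = 0" using complex_scale_eq_0[OF 0] y(1) by auto
      then have qw: "br q w \<in> C2" "br q (J w) \<in> C2"
        using e(2) e'(2) ee xC2 C_closed by (metis add.right_neutral scaleR_zero_left)+
      have "br q U \<in> C2" for U
      proof -
        obtain q' c d where q': "q' \<in> P" "U = q' + c *\<^sub>R w + d *\<^sub>R J w" using V_cases by blast
        show ?thesis
          unfolding q'(2) br_simps by (intro C_closed PP q q' qw)
      qed
      then show ?thesis by (rule C_SucI)
    qed
    have "k \<in> C3" using key[OF k_P] by simp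
    then have "p \<in> C3" using key[OF p(1)] P_C3[OF p(1)] by blast
    then show False using p(2) by contradiction
  qed
qed

lemma ascending_types:
  "ascending_type br \<in>
    {[1,3,8], [1,3,5,8], [1,3,6,8], [1,3,5,6,8], [1,4,8], [1,4,6,8], [1,5,8], [1,5,6,8]}"
proof -
  define d where "d k = dim (C k)" for k
  have d1: "d 1 = 1" and d2: "d 2 = 3 \<or> d 2 = 4 \<or> d 2 = 5"
    using dim_C1 dim_C2 by (auto simp: d_def numeral_2_eq_2)
  have d3: "d 2 = 3 \<Longrightarrow> d 3 \<noteq> 4" "d 2 = 4 \<Longrightarrow> 6 \<le> d 3"
    using dim_C3_not_4 dim_C3_if_dim_C2_eq_4
    by (auto simp: d_def numeral_2_eq_2 numeral_3_eq_3)
  have step: "d k < 8 \<Longrightarrow> d k < d (Suc k)" and le: "d k \<le> 8" and n7: "d (Suc k) \<noteq> 7" for k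
    using dim_step dim_le_8 dim_not_7 unfolding d_def by blast+
  have s2: "d 2 < d 3" using step[of 2] d2 by auto
  have s3: "d 3 < 8 \<Longrightarrow> d 3 < d 4" and s4: "d 4 < 8 \<Longrightarrow> d 4 < d 5"
    using step[of 3] step[of 4] by simp_all
  have n: "d 3 \<noteq> 7" "d 4 \<noteq> 7" "d 5 \<noteq> 7"
    using n7[of 2] n7[of 3] n7[of 4] by simp_all
  have l: "d 3 \<le> 8" "d 4 \<le> 8" "d 5 \<le> 8" using le by blast+
  have last: "\<lbrakk>d (Suc k) = 8; d k < 8\<rbrakk> \<Longrightarrow> ascending_type br = map d [1..<Suc (Suc k)]" for k
    using type_if_last[of k] unfolding d_def .
  have t3: "d 3 = 8 \<Longrightarrow> ascending_type br = [d 1, d 2, d 3]"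
    using last[of 2] d2 by (auto simp: upt_rec numeral_2_eq_2 numeral_3_eq_3)
  have t4: "\<lbrakk>d 4 = 8; d 3 < 8\<rbrakk> \<Longrightarrow> ascending_type br = [d 1, d 2, d 3, d 4]"
    using last[of 3] by (auto simp: upt_rec eval_nat_numeral)
  have t5: "\<lbrakk>d 5 = 8; d 4 < 8\<rbrakk> \<Longrightarrow> ascending_type br = [d 1, d 2, d 3, d 4, d 5]"
    using last[of 4] by (auto simp: upt_rec eval_nat_numeral)
  consider "d 3 = 8" | "d 3 = 5" "d 2 = 3" | "d 3 = 6"
    using d2 d3 s2 n(1) l(1) by linarith
  then show ?thesis
  proof cases
    case 1
    then show ?thesis using t3 d1 d2 by auto
  next
    case 2
    then consider "d 4 = 8" | "d 4 = 6" using s3 n(2) l(2) by linarith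
    then show ?thesis
    proof cases
      case 1
      then show ?thesis using t4 d1 2 by auto
    next
      case d4: 2
      then have "d 5 = 8" using s4 n(3) l(3) by linarith
      then show ?thesis using t5 d1 2 d4 by auto
    qed
  next
    case 3
    then have "d 4 = 8" using s3 n(2) l(2) by linarith
    then show ?thesis using t4 d1 d2 3 by auto
  qed
qed

end

theorem theorem4p1:
  fixes br :: "'a::real_vector \<Rightarrow> 'a \<Rightarrow> 'a"
  assumes "real_lie_algebra br"
    and "dim (UNIV :: 'a set) = 8"
    and "nilpotent_lie br"
    and "\<exists>J. complex_structure br J \<and> strongly_non_nilpotent br J"
  shows "ascending_type br \<in>
    {[1,3,8], [1,3,5,8], [1,3,6,8], [1,3,5,6,8], [1,4,8], [1,4,6,8], [1,5,8], [1,5,6,8]}"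
proof -
  obtain J where "complex_structure br J" "strongly_non_nilpotent br J"
    using assms(4) by blast
  then interpret snn_complex br J
    using assms(1-3) by unfold_locales
  show ?thesis by (rule ascending_types)
qed

end
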